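(* There exists a countable, finitely branching and acyclic MDP $\mathcal{M}$ with integer transition rewards and initial state $s_0$, whose step counter is implicit in the state, such that the value of $s_0$ for $\mathit{TP}_{\liminf\ge 0}=\{\rho\mid \liminf_{n\to\infty}\sum_{j=0}^{n-1} r(e_j)\ge 0\}$ is $1$, while every finite-memory randomized (FR) strategy $\sigma$ satisfies $\mathcal{P}_{\mathcal{M},s_0,\sigma}(\mathit{TP}_{\liminf\ge 0})=0$. In particular, for every $k\in\mathbb{N}$ and every $\varepsilon<1$ there are no $\varepsilon$-optimal $k$-bit Markov strategies for $\mathit{TP}_{\liminf\ge 0}$ in countable MDPs.
   Context: An MDP has a countable set of states partitioned into controlled and random states, a transition relation (every state has a successor), fixed probability distributions over successors at random states, and real rewards on transitions; runs are $s_0e_0s_1e_1\dots$ with transitions $e_j$. It is finitely branching if each state has finitely many successors and acyclic if its transition graph has no directed cycle. The step counter is implicit in the state if for every state $s$ all finite paths from $s_0$ to $s$ have the same length. A strategy assigns to each finite partial run ending in a controlled state a distribution over successors, inducing a probability measure on runs; the value is the supremum of the objective's probability over all strategies; $\varepsilon$-optimal means at least value$-\varepsilon$. FR strategies are those implementable with a finite set of memory modes and (possibly randomized) memory updates and choices depending on the current mode and state. A $k$-bit Markov strategy bases its choices on the current state, the number of steps taken so far, and $k$ bits of general-purpose memory. *)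

theory Defs
  imports "HOL-Probability.Probability"
begin

section \<open>Markov decision processes\<close>

text \<open>
  Transitions are pairs of states, so a run \<open>s\<^sub>0 e\<^sub>0 s\<^sub>1 e\<^sub>1 \<dots>\<close> is determined by its sequence of
  states, and runs and partial runs are represented by their state sequences.
  \<open>rand_prob\<close> matters only at random states and \<open>reward\<close> only on transitions.
\<close>

record 's mdp =
  controlled :: "'s set"
  random :: "'s set"
  transitions :: "('s \<times> 's) set"
  rand_prob :: "'s \<Rightarrow> 's pmf"
  reward :: "'s \<times> 's \<Rightarrow> real"

definition states :: "('s, 'z) mdp_scheme \<Rightarrow> 's set" where
  "states M = controlled M \<union> random M"

definition succs :: "('s, 'z) mdp_scheme \<Rightarrow> 's \<Rightarrow> 's set" where
  "succs M s = {t. (s, t) \<in> transitions M}"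

text \<open>Countability of the set of states is imposed by the class constraint.\<close>

definition is_mdp :: "('s::countable) mdp \<Rightarrow> bool" where
  "is_mdp M \<longleftrightarrow>
     controlled M \<inter> random M = {} \<and>
     transitions M \<subseteq> states M \<times> states M \<and>
     (\<forall>s\<in>states M. succs M s \<noteq> {}) \<and>
     (\<forall>s\<in>random M. set_pmf (rand_prob M s) \<subseteq> succs M s)"

definition finitely_branching :: "'s mdp \<Rightarrow> bool" where
  "finitely_branching M \<longleftrightarrow> (\<forall>s\<in>states M. finite (succs M s))"

definition partial_run :: "'s mdp \<Rightarrow> 's list \<Rightarrow> bool" where
  "partial_run M h \<longleftrightarrow>
     h \<noteq> [] \<and> set h \<subseteq> states M \<and> successively (\<lambda>s t. (s, t) \<in> transitions M) h"

definition step_counter_implicit :: "'s mdp \<Rightarrow> 's \<Rightarrow> bool" where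
  "step_counter_implicit M s0 \<longleftrightarrow>
     (\<forall>s g h. partial_run M g \<and> hd g = s0 \<and> last g = s \<and>
              partial_run M h \<and> hd h = s0 \<and> last h = s \<longrightarrow> length g = length h)"

definition runs :: "'s mdp \<Rightarrow> (nat \<Rightarrow> 's) set" where
  "runs M = {\<omega>. \<forall>i. (\<omega> i, \<omega> (Suc i)) \<in> transitions M}"

definition TP_liminf_ge0 :: "'s mdp \<Rightarrow> (nat \<Rightarrow> 's) set" where
  "TP_liminf_ge0 M =
     {\<omega> \<in> runs M. 0 \<le> liminf (\<lambda>n. ereal (\<Sum>j<n. reward M (\<omega> j, \<omega> (Suc j))))}"


section \<open>Strategies and the induced probability measure\<close>

text \<open>
  The values of a strategy on lists other than partial runs ending in a controlled state are
  irrelevant.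
\<close>

definition is_strategy :: "'s mdp \<Rightarrow> ('s list \<Rightarrow> 's pmf) \<Rightarrow> bool" where
  "is_strategy M \<sigma> \<longleftrightarrow>
     (\<forall>h. partial_run M h \<and> last h \<in> controlled M \<longrightarrow> set_pmf (\<sigma> h) \<subseteq> succs M (last h))"

definition next_pmf :: "'s mdp \<Rightarrow> ('s list \<Rightarrow> 's pmf) \<Rightarrow> 's list \<Rightarrow> 's pmf" where
  "next_pmf M \<sigma> h = (if last h \<in> controlled M then \<sigma> h else rand_prob M (last h))"

definition step_kernel ::
  "'s mdp \<Rightarrow> ('s list \<Rightarrow> 's pmf) \<Rightarrow> 's \<Rightarrow> nat \<Rightarrow> (nat \<Rightarrow> 's) \<Rightarrow> 's measure" where
  "step_kernel M \<sigma> s0 n \<omega> =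
     measure_pmf (if n = 0 then return_pmf s0 else next_pmf M \<sigma> (map \<omega> [0..<n]))"

text \<open>
  The measure is obtained by the Ionescu-Tulcea construction. It lives on all state sequences;
  \<open>run_measure_cylinder\<close> below shows that it is a probability measure with the
  usual values on cylinder sets. Countability of the state type is needed here, because otherwise
  the kernels need not be measurable.
\<close>

definition run_measure ::
  "('s::countable) mdp \<Rightarrow> ('s list \<Rightarrow> 's pmf) \<Rightarrow> 's \<Rightarrow> (nat \<Rightarrow> 's) measure" where
  "run_measure M \<sigma> s0 =
     projective_family.lim UNIV
       (Ionescu_Tulcea.CI (step_kernel M \<sigma> s0) (\<lambda>_. count_space UNIV)) (\<lambda>_. count_space UNIV)"

definition mdp_value :: "('s::countable) mdp \<Rightarrow> 's \<Rightarrow> (nat \<Rightarrow> 's) set \<Rightarrow> real" where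
  "mdp_value M s0 E = (SUP \<sigma>\<in>{\<sigma>. is_strategy M \<sigma>}. measure (run_measure M \<sigma> s0) E)"

definition eps_optimal ::
  "('s::countable) mdp \<Rightarrow> 's \<Rightarrow> (nat \<Rightarrow> 's) set \<Rightarrow> real \<Rightarrow> ('s list \<Rightarrow> 's pmf) \<Rightarrow> bool" where
  "eps_optimal M s0 E \<epsilon> \<sigma> \<longleftrightarrow>
     is_strategy M \<sigma> \<and> measure (run_measure M \<sigma> s0) E \<ge> mdp_value M s0 E - \<epsilon>"


section \<open>Strategies with memory\<close>

text \<open>
  A memory structure over a set \<open>A\<close> of modes is a transition function \<open>\<tau>\<close> of a Markov chain on
  pairs of a mode and a state: at a controlled state it jointly chooses the new mode and the
  successor; at a random state the successor follows the MDP, and the new mode may depend on it.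
\<close>

definition is_memory :: "'s mdp \<Rightarrow> 'm set \<Rightarrow> ('m \<times> 's \<Rightarrow> ('m \<times> 's) pmf) \<Rightarrow> bool" where
  "is_memory M A \<tau> \<longleftrightarrow>
     (\<forall>m\<in>A. \<forall>s\<in>states M.
        set_pmf (\<tau> (m, s)) \<subseteq> A \<times> succs M s \<and>
        (s \<in> random M \<longrightarrow> map_pmf snd (\<tau> (m, s)) = rand_prob M s))"

text \<open>The distribution of the first \<open>n + 1\<close> positions of that chain, started in \<open>x\<close>.\<close>

primrec chain_pmf :: "('x \<Rightarrow> 'x pmf) \<Rightarrow> 'x \<Rightarrow> nat \<Rightarrow> 'x list pmf" where
  "chain_pmf \<tau> x 0 = return_pmf [x]"
| "chain_pmf \<tau> x (Suc n) =
     bind_pmf (chain_pmf \<tau> x n) (\<lambda>w. map_pmf (\<lambda>y. w @ [y]) (\<tau> (last w)))"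

definition history_chain ::
  "('m \<times> 's \<Rightarrow> ('m \<times> 's) pmf) \<Rightarrow> 'm \<Rightarrow> 's list \<Rightarrow> ('m \<times> 's) list pmf" where
  "history_chain \<tau> m0 h = chain_pmf \<tau> (m0, hd h) (length h - 1)"

definition history_possible ::
  "('m \<times> 's \<Rightarrow> ('m \<times> 's) pmf) \<Rightarrow> 'm \<Rightarrow> 's list \<Rightarrow> bool" where
  "history_possible \<tau> m0 h \<longleftrightarrow> set_pmf (history_chain \<tau> m0 h) \<inter> {w. map snd w = h} \<noteq> {}"

text \<open>The distribution of the current mode, conditioned on the observed history of states.\<close>

definition mode_pmf :: "('m \<times> 's \<Rightarrow> ('m \<times> 's) pmf) \<Rightarrow> 'm \<Rightarrow> 's list \<Rightarrow> 'm pmf" where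
  "mode_pmf \<tau> m0 h =
     map_pmf (\<lambda>w. fst (last w)) (cond_pmf (history_chain \<tau> m0 h) {w. map snd w = h})"

text \<open>
  The conditional distribution is meaningful only for histories of positive probability, so
  agreement is required for those starting in \<open>s0\<close> only; other histories do not affect the run
  measure from \<open>s0\<close>.
\<close>

definition implements ::
  "'s mdp \<Rightarrow> 's \<Rightarrow> ('m \<times> 's \<Rightarrow> ('m \<times> 's) pmf) \<Rightarrow> 'm \<Rightarrow> ('s list \<Rightarrow> 's pmf) \<Rightarrow> bool" where
  "implements M s0 \<tau> m0 \<sigma> \<longleftrightarrow>
     (\<forall>h. partial_run M h \<and> hd h = s0 \<and> last h \<in> controlled M \<and> history_possible \<tau> m0 h \<longrightarrow>
        \<sigma> h = bind_pmf (mode_pmf \<tau> m0 h) (\<lambda>m. map_pmf snd (\<tau> (m, last h))))"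

text \<open>Every finite set of modes can be coded as a finite set of natural numbers.\<close>

definition FR_strategy :: "'s mdp \<Rightarrow> 's \<Rightarrow> ('s list \<Rightarrow> 's pmf) \<Rightarrow> bool" where
  "FR_strategy M s0 \<sigma> \<longleftrightarrow>
     is_strategy M \<sigma> \<and>
     (\<exists>(A :: nat set) m0 \<tau>. finite A \<and> m0 \<in> A \<and> is_memory M A \<tau> \<and> implements M s0 \<tau> m0 \<sigma>)"

text \<open>
  The modes are pairs of the step counter and \<open>k\<close> bits. The counter is a clock beyond the control
  of the strategy: it starts at 0 and increases by exactly one in each step.
\<close>

definition k_bit_Markov_strategy :: "nat \<Rightarrow> 's mdp \<Rightarrow> 's \<Rightarrow> ('s list \<Rightarrow> 's pmf) \<Rightarrow> bool" where
  "k_bit_Markov_strategy k M s0 \<sigma> \<longleftrightarrow>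
     is_strategy M \<sigma> \<and>
     (\<exists>(b0 :: bool list) \<tau>.
        length b0 = k \<and>
        is_memory M (UNIV \<times> {b. length b = k}) \<tau> \<and>
        (\<forall>(n :: nat) b. \<forall>s\<in>states M. length b = k \<longrightarrow>
           (\<forall>((n', b'), s') \<in> set_pmf (\<tau> ((n, b), s)). n' = Suc n)) \<and>
        implements M s0 \<tau> (0, b0) \<sigma>)"


section \<open>Basic facts about the run measure\<close>

lemma PiM_count_space_countable:
  "PiM {0..<n::nat} (\<lambda>_. count_space (UNIV :: 's::countable set)) =
     count_space (PiE {0..<n} (\<lambda>_. UNIV))"
  by (rule count_space_PiM_finite) auto

lemma Ionescu_Tulcea_step_kernel:
  "Ionescu_Tulcea (step_kernel M \<sigma> s0) (\<lambda>_. count_space (UNIV :: 's::countable set))"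
proof (rule Ionescu_Tulcea.intro)
  show "step_kernel M \<sigma> s0 n
      \<in> measurable (PiM {0..<n} (\<lambda>_. count_space UNIV)) (subprob_algebra (count_space UNIV))" for n
    unfolding PiM_count_space_countable measurable_count_space_eq1
    by (auto simp: step_kernel_def space_subprob_algebra
        intro!: prob_space_imp_subprob_space measure_pmf.prob_space_axioms)
  show "prob_space (step_kernel M \<sigma> s0 n \<omega>)" for n \<omega>
    by (simp add: step_kernel_def measure_pmf.prob_space_axioms)
qed

lemma sets_run_measure [measurable_cong]:
  "sets (run_measure M \<sigma> s0) = sets (PiM UNIV (\<lambda>_. count_space UNIV))"
proof -
  interpret Ionescu_Tulcea "step_kernel M \<sigma> s0" "\<lambda>_. count_space UNIV"
    by (rule Ionescu_Tulcea_step_kernel)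
  show ?thesis unfolding run_measure_def by (rule PF.sets_lim)
qed

lemma space_run_measure [simp]: "space (run_measure M \<sigma> s0) = UNIV"
  using sets_eq_imp_space_eq[OF sets_run_measure] by (simp add: space_PiM)

lemma run_measure_cylinder:
  fixes M :: "('s::countable) mdp"
  shows prob_space_run_measure: "prob_space (run_measure M \<sigma> s0)"
    and "emeasure (run_measure M \<sigma> s0) {\<omega>. map \<omega> [0..<Suc n] = h} =
      (if length h = Suc n \<and> hd h = s0
       then \<Prod>i\<in>{1..n}. ennreal (pmf (next_pmf M \<sigma> (take i h)) (h ! i)) else 0)"
proof -
  interpret Ionescu_Tulcea "step_kernel M \<sigma> s0" "\<lambda>_. count_space (UNIV :: 's set)"
    by (rule Ionescu_Tulcea_step_kernel)
  let ?S = "\<lambda>n. PiM {0..<n::nat} (\<lambda>_. count_space (UNIV :: 's set))"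
  let ?u = "\<lambda>_::nat. undefined :: 's"
  have lim_cyl: "emeasure (run_measure M \<sigma> s0) {\<omega>. restrict \<omega> {0..<n} \<in> X} = C 0 n ?u X"
    if X: "X \<in> sets (?S n)" for n X
  proof -
    have "{\<omega>. restrict \<omega> {0..<n} \<in> X} = PF.emb UNIV {0..<n} X"
      by (auto simp: prod_emb_def)
    then have "emeasure (run_measure M \<sigma> s0) {\<omega>. restrict \<omega> {0..<n} \<in> X} = CI {0..<n} X"
      unfolding run_measure_def using lim[OF _ X] by simp
    also have "\<dots> = C 0 n ?u (PF.emb {0..<n} {0..<n} X)"
      by (rule emeasure_CI) (use X in auto)
    also have "PF.emb {0..<n} {0..<n} X = X"
      using sets.sets_into_space[OF X] by (intro prod_emb_id) (simp add: space_PiM)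
    finally show ?thesis .
  qed
  have u: "?u \<in> space (?S 0)" by (simp add: space_PiM)
  have "emeasure (run_measure M \<sigma> s0) (space (run_measure M \<sigma> s0)) = 1"
  proof -
    have "{\<omega>. restrict \<omega> {0..<0} \<in> space (?S 0)} = space (run_measure M \<sigma> s0)"
      by (auto simp: space_PiM)
    then have "emeasure (run_measure M \<sigma> s0) (space (run_measure M \<sigma> s0)) = C 0 0 ?u (space (?S 0))"
      using lim_cyl[of "space (?S 0)" 0] by simp
    also have "\<dots> = 1"
      using prob_space.emeasure_space_1[OF prob_space_C[OF u, of 0]] space_C[OF u, of 0] by simp
    finally show ?thesis .
  qed
  then show "prob_space (run_measure M \<sigma> s0)" by (rule prob_spaceI)

  define X where "X n h = {\<omega> \<in> space (?S n). map \<omega> [0..<n] = h}" for n and h :: "'s list"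
  have X_sets: "X n h \<in> sets (?S n)" for n h
    unfolding PiM_count_space_countable X_def by auto
  have step: "C 0 (Suc n) ?u (X (Suc n) h) =
      (if length h = Suc n then
         ennreal (pmf (if n = 0 then return_pmf s0 else next_pmf M \<sigma> (take n h)) (h ! n)) *
         C 0 n ?u (X n (take n h)) else 0)"
    (is "_ = ?R") for n h
  proof (cases "length h = Suc n")
    case False
    then have "X (Suc n) h = {}" by (auto simp: X_def)
    then show ?thesis using False by (simp del: C.simps)
  next
    case True
    let ?p = "if n = 0 then return_pmf s0 else next_pmf M \<sigma> (take n h)"
    have C_meas: "C 0 n ?u \<in> space (subprob_algebra (?S n))"
      using measurable_C[of 0 n, THEN measurable_space, OF u] by simp
    have eP: "eP n \<in> measurable (C 0 n ?u) (subprob_algebra (?S (Suc n)))"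
      using measurable_eP[of n] sets_C[OF u, of n] by (simp cong: measurable_cong_sets)
    have "C 0 (Suc n) ?u (X (Suc n) h) = (\<integral>\<^sup>+\<omega>. emeasure (eP n \<omega>) (X (Suc n) h) \<partial>C 0 n ?u)"
      using emeasure_bind[OF _ eP X_sets[of "Suc n" h]] space_C[OF u, of n]
      by (simp add: space_PiM PiE_eq_empty_iff)
    also have "\<dots> = (\<integral>\<^sup>+\<omega>. ennreal (pmf ?p (h ! n)) * indicator (X n (take n h)) \<omega> \<partial>C 0 n ?u)"
    proof (rule nn_integral_cong)
      fix \<omega> assume "\<omega> \<in> space (C 0 n ?u)"
      then have \<omega>: "\<omega> \<in> space (?S n)" using space_C[OF u, of n] by simp
      have h: "h = take n h @ [h ! n]"
        using True by (metis lessI take_Suc_conv_app_nth take_all_iff order_refl)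
      have upd: "fun_upd \<omega> n x \<in> space (?S (Suc n))" for x
        using \<omega> by (auto simp: space_PiM PiE_iff extensional_def)
      have *: "map (fun_upd \<omega> n x) [0..<Suc n] = map \<omega> [0..<n] @ [x]" for x
        by simp
      have **: "map \<omega> [0..<n] @ [x] = h \<longleftrightarrow> map \<omega> [0..<n] = take n h \<and> x = h ! n" for x
        by (subst h) simp
      have pre: "(\<lambda>x. fun_upd \<omega> n x) -` X (Suc n) h \<inter> space (count_space UNIV) =
          (if \<omega> \<in> X n (take n h) then {h ! n} else {})"
        using \<omega> upd by (auto simp: X_def * ** simp del: upt_Suc)
      show "emeasure (eP n \<omega>) (X (Suc n) h) =
          ennreal (pmf ?p (h ! n)) * indicator (X n (take n h)) \<omega>"
        unfolding emeasure_eP[OF \<omega> X_sets] pre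
        by (auto simp: step_kernel_def emeasure_pmf_single X_def)
    qed
    also have "\<dots> = ennreal (pmf ?p (h ! n)) * C 0 n ?u (X n (take n h))"
      by (rule nn_integral_cmult_indicator) (simp add: sets_C[OF u] X_sets[of n, simplified])
    finally show ?thesis using True by simp
  qed
  have C_eq: "C 0 (Suc n) ?u (X (Suc n) h) =
      (if length h = Suc n \<and> hd h = s0
       then \<Prod>i\<in>{1..n}. ennreal (pmf (next_pmf M \<sigma> (take i h)) (h ! i)) else 0)" for n h
  proof (induction n arbitrary: h)
    case 0
    have "C 0 0 ?u (X 0 []) = 1"
      using prob_space.emeasure_space_1[OF prob_space_C[OF u, of 0]] space_C[OF u, of 0]
      by (simp add: X_def)
    then show ?case
      by (subst step) (auto simp: length_Suc_conv)
  next
    case (Suc n)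
    show ?case
    proof (cases "length h = Suc (Suc n)")
      case True
      then have hd: "hd (take (Suc n) h) = hd h" by (cases h) auto
      have "(\<Prod>i\<in>{1..n}. ennreal (pmf (next_pmf M \<sigma> (take i (take (Suc n) h))) (take (Suc n) h ! i)))
          = (\<Prod>i\<in>{1..n}. ennreal (pmf (next_pmf M \<sigma> (take i h)) (h ! i)))"
        by (rule prod.cong) (auto simp: min_def)
      then show ?thesis
        using True by (subst step) (simp add: Suc.IH hd prod.nat_ivl_Suc' mult.commute del: C.simps take_Suc)
    next
      case False
      then show ?thesis by (subst step) simp
    qed
  qed
  have "{\<omega>. map \<omega> [0..<Suc n] = h} = {\<omega>. restrict \<omega> {0..<Suc n} \<in> X (Suc n) h}"
  proof -
    have "map (restrict \<omega> {0..<Suc n}) [0..<Suc n] = map \<omega> [0..<Suc n]" for \<omega> :: "nat \<Rightarrow> 's"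
      by (rule map_cong) auto
    then show ?thesis by (auto simp: X_def space_PiM simp del: upt_Suc)
  qed
  then show "emeasure (run_measure M \<sigma> s0) {\<omega>. map \<omega> [0..<Suc n] = h} =
      (if length h = Suc n \<and> hd h = s0
       then \<Prod>i\<in>{1..n}. ennreal (pmf (next_pmf M \<sigma> (take i h)) (h ! i)) else 0)"
    by (simp only: lim_cyl[OF X_sets] C_eq)
qed

lemma sets_TP_liminf_ge0 [measurable]:
  fixes M :: "('s::countable) mdp"
  shows "TP_liminf_ge0 M \<in> sets (run_measure M \<sigma> s0)"
proof -
  let ?P = "PiM UNIV (\<lambda>_. count_space (UNIV :: 's set)) :: (nat \<Rightarrow> 's) measure"
  have pair: "(\<lambda>\<omega>. (\<omega> i, \<omega> (Suc i))) \<in> measurable ?P (count_space UNIV)" for i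
  proof -
    have "(\<lambda>\<omega>. (\<omega> i, \<omega> (Suc i))) \<in> measurable ?P (count_space UNIV \<Otimes>\<^sub>M count_space UNIV)"
      by measurable
    then show ?thesis by (simp add: pair_measure_countable)
  qed
  have rew [measurable]: "(\<lambda>\<omega>. reward M (\<omega> i, \<omega> (Suc i))) \<in> borel_measurable ?P" for i
    by (rule measurable_compose[OF pair]) simp
  have edge [measurable]: "Measurable.pred ?P (\<lambda>\<omega>. (\<omega> i, \<omega> (Suc i)) \<in> transitions M)" for i
    by (rule measurable_compose[OF pair]) simp
  have "{\<omega> \<in> space ?P. (\<forall>i. (\<omega> i, \<omega> (Suc i)) \<in> transitions M) \<and>
      0 \<le> liminf (\<lambda>n. ereal (\<Sum>j<n. reward M (\<omega> j, \<omega> (Suc j))))} \<in> sets ?P"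
    by measurable
  then show ?thesis
    by (simp add: sets_run_measure TP_liminf_ge0_def runs_def space_PiM)
qed

end

theory Submission
  imports Defs
begin

text \<open>
  The game consists of stages. In a stage a random level \<open>i\<close> is drawn and rewarded, and after \<open>i\<close> has
  become invisible the controller has to pick a level \<open>j\<close> and pays for it, up to a bonus of 1. Picking
  \<open>j > i\<close> makes the total payoff negative, and so does a random penalty whose probability decreases
  geometrically in \<open>j\<close>. High levels are correspondingly more likely, so that the total risk of the
  choice \<open>j = i\<close> is summable over the stages: by Borel-Cantelli only finitely many penalties occur almost
  surely, and then the bonuses drive the total payoff to infinity.

  With at most \<open>K\<close> modes at each step, two levels \<open>i < i'\<close> lead to the same mode with probability at
  least \<open>1 / K\<close> each. Every choice \<open>j\<close> made in that mode is greater than \<open>i\<close>, or less than \<open>i'\<close>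
  and thus too risky for \<open>i'\<close>, and the resulting probabilities of a negative payoff in stage \<open>t\<close> have
  a divergent sum. As payoffs are integers, almost surely their limit inferior is negative. Clock and
  bits together form unboundedly many modes, but boundedly many at each step, so both classes of
  strategies are treated at once.
\<close>

section \<open>Finite prefixes of runs\<close>

text \<open>Distribution of the first \<open>n + 1\<close> states. Events decided by finitely many
  steps are treated in the pmf calculus; \<open>distr_run_measure_prefix\<close> carries the results
  over to the run measure.\<close>

primrec prefix_pmf :: "'s mdp \<Rightarrow> ('s list \<Rightarrow> 's pmf) \<Rightarrow> 's \<Rightarrow> nat \<Rightarrow> 's list pmf" where
  "prefix_pmf M \<sigma> s 0 = return_pmf [s]"
| "prefix_pmf M \<sigma> s (Suc n) =
     bind_pmf (prefix_pmf M \<sigma> s n) (\<lambda>h. map_pmf (\<lambda>y. h @ [y]) (next_pmf M \<sigma> h))"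

lemma prob_bind_pmf:
  "measure_pmf.prob (bind_pmf p f) X = (\<integral>x. measure_pmf.prob (f x) X \<partial>measure_pmf p)"
proof -
  have "ennreal (measure_pmf.prob (bind_pmf p f) X) = (\<integral>\<^sup>+x. ennreal (measure_pmf.prob (f x) X) \<partial>p)"
    by (simp flip: measure_pmf.emeasure_eq_measure)
  also have "\<dots> = ennreal (\<integral>x. measure_pmf.prob (f x) X \<partial>measure_pmf p)"
    by (intro nn_integral_eq_integral measure_pmf.integrable_const_bound[where B=1]) auto
  finally show ?thesis
    by (subst (asm) ennreal_inj) (auto intro: integral_nonneg_AE)
qed

text \<open>One conditioning step: \<open>Y\<close> is an event of the past outside of which
  \<open>X\<close> is impossible, and inside of which \<open>X\<close> has conditional probability
  at most \<open>c\<close>.\<close>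

lemma prob_bind_pmf_le:
  assumes "\<And>w. w \<in> set_pmf p \<Longrightarrow> measure_pmf.prob (f w) X \<le> c * indicator Y w"
  shows "measure_pmf.prob (bind_pmf p f) X \<le> c * measure_pmf.prob p Y"
proof -
  have "measure_pmf.prob (bind_pmf p f) X \<le> (\<integral>w. c * indicator Y w \<partial>p)"
    unfolding prob_bind_pmf
    by (rule integral_mono_AE)
       (auto simp: assms AE_measure_pmf_iff intro!: measure_pmf.integrable_const_bound[where B = 1])
  then show ?thesis by simp
qed

lemma length_prefix_pmf:
  "h \<in> set_pmf (prefix_pmf M \<sigma> s n) \<Longrightarrow> length h = Suc n \<and> hd h = s"
  by (induction n arbitrary: h) (fastforce simp: hd_append)+

lemma pmf_bind_snoc:
  "pmf (bind_pmf p (\<lambda>h. map_pmf (\<lambda>y. h @ [y]) (f h))) (g @ [y]) = pmf p g * pmf (f g) y"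
proof -
  have *: "pmf (map_pmf (\<lambda>y. h @ [y]) (f h)) (g @ [y]) = pmf (f g) y * indicat_real {g} h" for h
  proof (cases "h = g")
    case True
    then show ?thesis
      using pmf_map_inj'[of "\<lambda>y. g @ [y]" "f g" y] by (simp add: inj_def)
  next
    case False
    then show ?thesis
      by (auto simp: pmf_eq_0_set_pmf)
  qed
  show ?thesis
    by (simp add: pmf_bind * measure_pmf_single)
qed

lemma pmf_prefix_pmf:
  "pmf (prefix_pmf M \<sigma> s n) h =
     (if length h = Suc n \<and> hd h = s
      then \<Prod>i\<in>{1..n}. pmf (next_pmf M \<sigma> (take i h)) (h ! i) else 0)"
proof (induction n arbitrary: h)
  case 0
  show ?case by (auto simp: length_Suc_conv indicator_def)
next
  case (Suc n)
  show ?case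
  proof (cases "length h = Suc (Suc n) \<and> hd h = s")
    case True
    then obtain g y where h: "h = g @ [y]" and g: "length g = Suc n"
      by (metis length_Suc_conv_rev)
    have hd: "hd g = s" using True h g by (cases g) auto
    have "(\<Prod>i\<in>{1..n}. pmf (next_pmf M \<sigma> (take i h)) (h ! i)) =
        (\<Prod>i\<in>{1..n}. pmf (next_pmf M \<sigma> (take i g)) (g ! i))"
      by (rule prod.cong) (auto simp: h g nth_append)
    then show ?thesis
      using True g hd Suc.IH[of g]
      by (simp add: h pmf_bind_snoc prod.nat_ivl_Suc' mult.commute nth_append)
  next
    case False
    then have "h \<notin> set_pmf (prefix_pmf M \<sigma> s (Suc n))"
      using length_prefix_pmf[of h M \<sigma> s "Suc n"] by blast
    then show ?thesis using False by (auto simp only: pmf_eq_0_set_pmf if_False)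
  qed
qed

text \<open>Lists over a countable type are countable, so preimages of singletons suffice, and these
  are finite intersections of coordinate events.\<close>

lemma measurable_prefix [measurable]:
  "(\<lambda>\<omega>. map \<omega> [0..<n]) \<in> measurable (PiM UNIV (\<lambda>_. count_space (UNIV :: 's::countable set)))
     (count_space UNIV)"
proof (rule measurable_count_space_eq2_countable[THEN iffD2, OF conjI, OF _ ballI])
  fix h :: "'s list"
  have eq: "map \<omega> [0..<n] = h \<longleftrightarrow> length h = n \<and> (\<forall>i<n. \<omega> i = h ! i)" for \<omega> :: "nat \<Rightarrow> 's"
    by (subst list_eq_iff_nth_eq) auto
  have "(\<lambda>\<omega>. map \<omega> [0..<n]) -` {h} \<inter> space (PiM UNIV (\<lambda>_. count_space UNIV)) =
    {\<omega> \<in> space (PiM UNIV (\<lambda>_. count_space (UNIV :: 's set))). length h = n \<and> (\<forall>i<n. \<omega> i = h ! i)}"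
    using eq by (auto simp: space_PiM)
  also have "\<dots> \<in> sets (PiM UNIV (\<lambda>_. count_space (UNIV :: 's set)))"
    by measurable
  finally show "(\<lambda>\<omega>. map \<omega> [0..<n]) -` {h} \<inter> space (PiM UNIV (\<lambda>_. count_space UNIV))
      \<in> sets (PiM UNIV (\<lambda>_. count_space (UNIV :: 's set)))" .
qed simp

text \<open>On a countable space it is enough to compare singletons, where
  \<open>run_measure_cylinder\<close> and \<open>pmf_prefix_pmf\<close> give the same
  product.\<close>

lemma distr_run_measure_prefix:
  fixes M :: "('s::countable) mdp"
  shows "distr (run_measure M \<sigma> s0) (count_space UNIV) (\<lambda>\<omega>. map \<omega> [0..<Suc n]) =
     measure_pmf (prefix_pmf M \<sigma> s0 n)"
proof (rule measure_eqI_countable[where A = UNIV])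
  fix h :: "'s list"
  have "emeasure (distr (run_measure M \<sigma> s0) (count_space UNIV) (\<lambda>\<omega>. map \<omega> [0..<Suc n])) {h} =
      emeasure (run_measure M \<sigma> s0) {\<omega>. map \<omega> [0..<Suc n] = h}"
    by (subst emeasure_distr) (auto simp: vimage_def simp del: upt_Suc)
  also have "\<dots> = emeasure (prefix_pmf M \<sigma> s0 n) {h}"
    unfolding run_measure_cylinder(2) emeasure_pmf_single pmf_prefix_pmf
    by (simp add: prod_ennreal)
  finally show "emeasure (distr (run_measure M \<sigma> s0) (count_space UNIV)
      (\<lambda>\<omega>. map \<omega> [0..<Suc n])) {h} = emeasure (prefix_pmf M \<sigma> s0 n) {h}" .
qed auto

lemma sets_prefix_event [measurable]:
  fixes M :: "('s::countable) mdp"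
  shows "{\<omega>. map \<omega> [0..<n] \<in> X} \<in> sets (run_measure M \<sigma> s0)"
proof -
  have "{\<omega> \<in> space (run_measure M \<sigma> s0). map \<omega> [0..<n] \<in> X} \<in> sets (run_measure M \<sigma> s0)"
    by measurable
  then show ?thesis by simp
qed

lemma measure_prefix_event:
  fixes M :: "('s::countable) mdp"
  shows "measure (run_measure M \<sigma> s0) {\<omega>. map \<omega> [0..<Suc n] \<in> X} =
    measure_pmf.prob (prefix_pmf M \<sigma> s0 n) X"
  unfolding distr_run_measure_prefix[symmetric]
  by (subst measure_distr) (auto simp: vimage_def simp del: upt_Suc)

lemma AE_prefix:
  fixes M :: "('s::countable) mdp"
  shows "AE \<omega> in run_measure M \<sigma> s0. \<forall>n. map \<omega> [0..<Suc n] \<in> set_pmf (prefix_pmf M \<sigma> s0 n)"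
proof (subst AE_all_countable, rule allI)
  fix n
  have "AE h in distr (run_measure M \<sigma> s0) (count_space UNIV) (\<lambda>\<omega>. map \<omega> [0..<Suc n]).
      h \<in> set_pmf (prefix_pmf M \<sigma> s0 n)"
    unfolding distr_run_measure_prefix by (simp add: AE_measure_pmf_iff)
  then show "AE \<omega> in run_measure M \<sigma> s0. map \<omega> [0..<Suc n] \<in> set_pmf (prefix_pmf M \<sigma> s0 n)"
    by (subst (asm) AE_distr_iff) (auto simp del: upt_Suc)
qed

lemma partial_run_snoc:
  assumes "partial_run M h" "(last h, y) \<in> transitions M" "y \<in> states M"
  shows "partial_run M (h @ [y])"
  using assms by (auto simp: partial_run_def successively_append_iff)

lemma prefix_pmf_partial_run:
  assumes M: "is_mdp M" and \<sigma>: "is_strategy M \<sigma>" and s0: "s0 \<in> states M"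
    and "h \<in> set_pmf (prefix_pmf M \<sigma> s0 n)"
  shows "partial_run M h"
  using assms(4)
proof (induction n arbitrary: h)
  case 0
  then show ?case using s0 by (simp add: partial_run_def)
next
  case (Suc n)
  then obtain g y where g: "g \<in> set_pmf (prefix_pmf M \<sigma> s0 n)"
    and y: "y \<in> set_pmf (next_pmf M \<sigma> g)" and h: "h = g @ [y]"
    by auto
  have run: "partial_run M g" by (rule Suc.IH[OF g])
  then have "last g \<in> states M" by (auto simp: partial_run_def)
  then have "y \<in> succs M (last g)"
    using y run \<sigma> M unfolding next_pmf_def is_strategy_def is_mdp_def states_def
    by (auto split: if_splits)
  then have "(last g, y) \<in> transitions M" by (simp add: succs_def)
  moreover from this have "y \<in> states M" using M by (auto simp: is_mdp_def)
  ultimately show ?case unfolding h by (rule partial_run_snoc[OF run])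
qed

text \<open>A further step only appends to the history, so the law of an earlier position does not
  depend on the horizon.\<close>

lemma map_nth_prefix_pmf_Suc:
  assumes "i \<le> n"
  shows "map_pmf (\<lambda>h. f (h ! i)) (prefix_pmf M \<sigma> s (Suc n)) = map_pmf (\<lambda>h. f (h ! i)) (prefix_pmf M \<sigma> s n)"
proof -
  have "map_pmf (\<lambda>h. f (h ! i)) (prefix_pmf M \<sigma> s (Suc n)) =
      bind_pmf (prefix_pmf M \<sigma> s n) (\<lambda>h. map_pmf (\<lambda>y. f ((h @ [y]) ! i)) (next_pmf M \<sigma> h))"
    by (simp add: map_bind_pmf map_pmf_comp)
  also have "\<dots> = bind_pmf (prefix_pmf M \<sigma> s n) (\<lambda>h. return_pmf (f (h ! i)))"
    by (rule bind_pmf_cong)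
       (use assms in \<open>auto dest!: length_prefix_pmf simp: nth_append\<close>)
  finally show ?thesis by (simp add: map_pmf_def)
qed

section \<open>Strategies with memory as marginals of chains with visible modes\<close>

lemma is_memory_set_pmf:
  "is_memory M A \<tau> \<Longrightarrow> m \<in> A \<Longrightarrow> s \<in> states M \<Longrightarrow> set_pmf (\<tau> (m, s)) \<subseteq> A \<times> succs M s"
  unfolding is_memory_def by blast

text \<open>Law of total probability: drawing the value of \<open>f\<close> first and conditioning
  on it afterwards reproduces \<open>p\<close>.\<close>

lemma bind_map_cond_pmf:
  "bind_pmf (map_pmf f p) (\<lambda>h. cond_pmf p {w. f w = h}) = p"
proof (rule bind_cond_pmf_cancel)
  show "measure_pmf.prob p {w. f w = h} = measure_pmf.prob (map_pmf f p) {h. f w = h}"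
    if "f w = h" for h w
    using that by (simp add: vimage_def)
qed auto

lemma length_chain_pmf:
  "w \<in> set_pmf (chain_pmf \<tau> x n) \<Longrightarrow> length w = Suc n \<and> hd w = x"
  by (induction n arbitrary: w) (fastforce simp: hd_append)+

lemma chain_pmf_partial_run:
  assumes mem: "is_memory M A \<tau>" and "is_mdp M" "m0 \<in> A" "s0 \<in> states M"
    and "w \<in> set_pmf (chain_pmf \<tau> (m0, s0) n)"
  shows "fst (last w) \<in> A \<and> partial_run M (map snd w)"
  using assms(5)
proof (induction n arbitrary: w)
  case 0
  then show ?case using assms by (auto simp: partial_run_def)
next
  case (Suc n)
  then obtain v y where v: "v \<in> set_pmf (chain_pmf \<tau> (m0, s0) n)"
    and y: "y \<in> set_pmf (\<tau> (last v))" and w: "w = v @ [y]"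
    by auto
  have IH: "fst (last v) \<in> A" "partial_run M (map snd v)" using Suc.IH[OF v] by auto
  have ne: "v \<noteq> []" using length_chain_pmf[OF v] by auto
  then have "snd (last v) \<in> states M" using IH by (auto simp: partial_run_def)
  then have "set_pmf (\<tau> (last v)) \<subseteq> A \<times> succs M (snd (last v))"
    using mem IH(1) unfolding is_memory_def by (metis prod.collapse)
  then have *: "fst y \<in> A" "(snd (last v), snd y) \<in> transitions M"
    using y by (auto simp: succs_def)
  then have "snd y \<in> states M" using \<open>is_mdp M\<close> by (auto simp: is_mdp_def)
  then show ?case
    using * IH(2) ne partial_run_snoc[of M "map snd v" "snd y"] by (simp add: w last_map)
qed

text \<open>By \<open>implements\<close>, the choice of \<open>\<sigma>\<close> after
  \<open>h\<close> is the choice of the memory structure averaged over the mode given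
  \<open>h\<close>. Hence forgetting the modes of the chain yields the prefixes under
  \<open>\<sigma>\<close>, and bounds may be proved on the chain, where the mode is visible.\<close>

lemma map_snd_chain_pmf:
  assumes mem: "is_memory M A \<tau>" and mdp: "is_mdp M" and m0: "m0 \<in> A" and s0: "s0 \<in> states M"
    and imp: "implements M s0 \<tau> m0 \<sigma>"
  shows "map_pmf (map snd) (chain_pmf \<tau> (m0, s0) n) = prefix_pmf M \<sigma> s0 n"
proof (induction n)
  case 0
  show ?case by simp
next
  case (Suc n)
  let ?P = "chain_pmf \<tau> (m0, s0) n"
  let ?C = "\<lambda>h. cond_pmf ?P {w. map snd w = h}"
  have step: "bind_pmf (?C h) (\<lambda>w. map_pmf snd (\<tau> (last w))) = next_pmf M \<sigma> h"
    if h: "h \<in> set_pmf (map_pmf (map snd) ?P)" for h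
  proof -
    obtain w where w: "w \<in> set_pmf ?P" "h = map snd w" using h by auto
    have ne: "set_pmf ?P \<inter> {w. map snd w = h} \<noteq> {}" using w by auto
    have run: "partial_run M h" using chain_pmf_partial_run[OF mem mdp m0 s0 w(1)] w(2) by simp
    have len: "length h = Suc n" "hd h = s0"
      using length_chain_pmf[OF w(1)] w(2) by (cases w; auto)+
    have last: "snd (last v) = last h" "fst (last v) \<in> A"
      if "v \<in> set_pmf ?P" "map snd v = h" for v
      using that len chain_pmf_partial_run[OF mem mdp m0 s0 that(1)] length_chain_pmf[OF that(1)]
      by (cases v; auto simp: last_map)+
    have hist: "history_chain \<tau> m0 h = ?P" using len by (simp add: history_chain_def)
    show ?thesis
    proof (cases "last h \<in> controlled M")
      case True
      have "\<sigma> h = bind_pmf (mode_pmf \<tau> m0 h) (\<lambda>m. map_pmf snd (\<tau> (m, last h)))"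
        using imp run len True ne by (simp add: implements_def history_possible_def hist)
      also have "\<dots> = bind_pmf (?C h) (\<lambda>w. map_pmf snd (\<tau> (fst (last w), last h)))"
        by (simp add: mode_pmf_def hist bind_map_pmf)
      also have "\<dots> = bind_pmf (?C h) (\<lambda>w. map_pmf snd (\<tau> (last w)))"
      proof (rule bind_pmf_cong[OF refl])
        fix v assume "v \<in> set_pmf (?C h)"
        then have "snd (last v) = last h" using last by (auto simp: set_cond_pmf[OF ne])
        then show "map_pmf snd (\<tau> (fst (last v), last h)) = map_pmf snd (\<tau> (last v))"
          by (metis prod.collapse)
      qed
      finally show ?thesis using True by (simp add: next_pmf_def)
    next
      \<comment> \<open>At a random state every mode prescribes the same law of the successor, so
        averaging over modes changes nothing.\<close>
      case False
      have st: "last h \<in> states M" using run by (auto simp: partial_run_def)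
      with False have rand: "last h \<in> random M" by (auto simp: states_def)
      have "bind_pmf (?C h) (\<lambda>w. map_pmf snd (\<tau> (last w))) =
          bind_pmf (?C h) (\<lambda>w. rand_prob M (last h))"
      proof (rule bind_pmf_cong[OF refl])
        fix v assume "v \<in> set_pmf (?C h)"
        then have v: "v \<in> set_pmf ?P" "map snd v = h" by (auto simp: set_cond_pmf[OF ne])
        have "map_pmf snd (\<tau> (fst (last v), last h)) = rand_prob M (last h)"
          using mem rand st last[OF v] unfolding is_memory_def by blast
        then show "map_pmf snd (\<tau> (last v)) = rand_prob M (last h)"
          using last[OF v] by (metis prod.collapse)
      qed
      then show ?thesis using False by (simp add: next_pmf_def)
    qed
  qed
  have "map_pmf (map snd) (chain_pmf \<tau> (m0, s0) (Suc n)) =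
      bind_pmf ?P (\<lambda>w. map_pmf (\<lambda>y. map snd w @ [y]) (map_pmf snd (\<tau> (last w))))"
    by (simp add: map_bind_pmf map_pmf_comp)
  \<comment> \<open>The chain is split into the observed history and its conditional law given that
    history, to which \<open>step\<close> applies.\<close>
  also have "\<dots> = bind_pmf (map_pmf (map snd) ?P) (\<lambda>h. bind_pmf (?C h)
      (\<lambda>w. map_pmf (\<lambda>y. map snd w @ [y]) (map_pmf snd (\<tau> (last w)))))"
    by (subst (1) bind_map_cond_pmf[of "map snd" ?P, symmetric], subst bind_assoc_pmf) (rule refl)
  also have "\<dots> = bind_pmf (map_pmf (map snd) ?P)
      (\<lambda>h. map_pmf (\<lambda>y. h @ [y]) (next_pmf M \<sigma> h))"
  proof (rule bind_pmf_cong[OF refl])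
    fix h assume h: "h \<in> set_pmf (map_pmf (map snd) ?P)"
    then have ne: "set_pmf ?P \<inter> {w. map snd w = h} \<noteq> {}" by auto
    have "bind_pmf (?C h) (\<lambda>w. map_pmf (\<lambda>y. map snd w @ [y]) (map_pmf snd (\<tau> (last w)))) =
        bind_pmf (?C h) (\<lambda>w. map_pmf (\<lambda>y. h @ [y]) (map_pmf snd (\<tau> (last w))))"
      by (rule bind_pmf_cong) (auto simp: set_cond_pmf[OF ne])
    also have "\<dots> = map_pmf (\<lambda>y. h @ [y]) (bind_pmf (?C h) (\<lambda>w. map_pmf snd (\<tau> (last w))))"
      by (simp add: map_bind_pmf)
    finally show "bind_pmf (?C h) (\<lambda>w. map_pmf (\<lambda>y. map snd w @ [y]) (map_pmf snd (\<tau> (last w)))) =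
        map_pmf (\<lambda>y. h @ [y]) (next_pmf M \<sigma> h)"
      by (simp only: step[OF h])
  qed
  finally show ?case by (simp add: Suc.IH)
qed

section \<open>Levels and risks\<close>

text \<open>
  \<open>level_weight l\<close> normalizes \<open>level_pmf l\<close> and is also the number of consecutive stages of level
  \<open>l\<close>. With this choice, coping with a lost level costs about \<open>1 / level_weight l\<close> per stage, hence
  \<open>1\<close> per block, whereas perfect recall costs only \<open>Suc l / 2 ^ l\<close> per block.
\<close>

definition level_weight :: "nat \<Rightarrow> nat" where
  "level_weight l = (\<Sum>i\<le>l. (2 ^ l) ^ i)"

definition block_start :: "nat \<Rightarrow> nat" where
  "block_start l = (\<Sum>k<l. level_weight k)"

text \<open>The blocks partition the stages, because every \<open>level_weight\<close> is positive;
  this is the index of the block containing stage \<open>t\<close>.\<close>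

definition level :: "nat \<Rightarrow> nat" where
  "level t = (LEAST l. t < block_start (Suc l))"

definition level_pmf :: "nat \<Rightarrow> nat pmf" where
  "level_pmf l = embed_pmf (\<lambda>i. if i \<le> l then (2 ^ l) ^ i / real (level_weight l) else 0)"

text \<open>The reciprocal of the unnormalized weight \<open>(2 ^ l) ^ j\<close>, reduced by a
  further factor \<open>2 ^ l\<close>. Weighted with the probability of the drawn \<open>i\<close>,
  the choice \<open>j = i\<close> is therefore cheap, while \<open>j < i\<close> costs at least
  \<open>1 / level_weight l\<close>.\<close>

definition risk :: "nat \<Rightarrow> nat \<Rightarrow> real" where
  "risk l j = 1 / (2 ^ l) ^ Suc j"

lemma risk_bounds: "0 \<le> risk l j" "risk l j \<le> 1"
  by (auto simp: risk_def simp flip: power_mult power_add power_Suc)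

lemma level_weight_ge_1: "1 \<le> level_weight l"
proof -
  have "(2 ^ l) ^ 0 \<le> level_weight l"
    unfolding level_weight_def by (rule member_le_sum) auto
  then show ?thesis by simp
qed

lemma real_level_weight: "real (level_weight l) = (\<Sum>i\<le>l. (2 ^ l) ^ i)"
  by (simp add: level_weight_def)

lemma pmf_level_pmf:
  "pmf (level_pmf l) i = (if i \<le> l then (2 ^ l) ^ i / real (level_weight l) else 0)"
  unfolding level_pmf_def
proof (rule pmf_embed_pmf)
  show "0 \<le> (if i \<le> l then (2 ^ l) ^ i / real (level_weight l) else 0)" for i
    by simp
  have pos: "real (level_weight l) > 0" using level_weight_ge_1[of l] by simp
  have "(\<integral>\<^sup>+ i. ennreal (if i \<le> l then (2 ^ l) ^ i / real (level_weight l) else 0) \<partial>count_space UNIV)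
      = (\<integral>\<^sup>+ i. ennreal ((2 ^ l) ^ i / real (level_weight l)) * indicator {..l} i \<partial>count_space UNIV)"
    by (rule nn_integral_cong) auto
  also have "\<dots> = (\<Sum>i\<le>l. ennreal ((2 ^ l) ^ i / real (level_weight l)))"
    by (subst nn_integral_count_space_indicator[symmetric]) (auto simp: nn_integral_count_space_finite)
  also have "\<dots> = ennreal (\<Sum>i\<le>l. (2 ^ l) ^ i / real (level_weight l))"
    by (rule sum_ennreal) simp
  also have "(\<Sum>i\<le>l. (2 ^ l) ^ i / real (level_weight l)) = 1"
    using pos by (simp add: sum_divide_distrib[symmetric] real_level_weight)
  finally show "(\<integral>\<^sup>+ i. ennreal (if i \<le> l then (2 ^ l) ^ i / real (level_weight l) else 0)
      \<partial>count_space UNIV) = 1" by simp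
qed

lemma set_level_pmf: "set_pmf (level_pmf l) \<subseteq> {..l}"
  by (auto simp: set_pmf_eq pmf_level_pmf split: if_splits)

text \<open>The weights cancel the risks, so all \<open>Suc l\<close> levels contribute
  equally.\<close>

lemma expectation_risk:
  "(\<integral>i. risk l i \<partial>level_pmf l) = real (Suc l) / (2 ^ l * real (level_weight l))"
proof -
  have "(\<integral>i. risk l i \<partial>level_pmf l) = (\<Sum>i\<le>l. risk l i * pmf (level_pmf l) i)"
    by (rule integral_measure_pmf_real) (use set_level_pmf in auto)
  also have "\<dots> = (\<Sum>i\<le>l. 1 / (2 ^ l * real (level_weight l)))"
    by (rule sum.cong) (auto simp: risk_def pmf_level_pmf)
  finally show ?thesis by simp
qed

lemma level_pmf_ge: "i \<le> l \<Longrightarrow> 1 / level_weight l \<le> pmf (level_pmf l) i"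
  by (simp add: pmf_level_pmf divide_right_mono)

text \<open>Since \<open>Suc j \<le> i\<close>, the weight of \<open>i\<close> makes up for the
  factor in the denominator of the risk.\<close>

lemma level_pmf_risk_ge:
  assumes "j < i" "i \<le> l"
  shows "1 / level_weight l \<le> pmf (level_pmf l) i * risk l j"
proof -
  have "(2 ^ l :: real) ^ Suc j \<le> (2 ^ l) ^ i"
    using assms by (intro power_increasing) auto
  then have "1 \<le> (2 ^ l :: real) ^ i / (2 ^ l) ^ Suc j" by simp
  then have "1 / level_weight l \<le> (2 ^ l) ^ i / (2 ^ l) ^ Suc j / level_weight l"
    by (rule divide_right_mono) simp
  then show ?thesis using assms by (simp add: pmf_level_pmf risk_def mult.commute)
qed

section \<open>Blocks of stages and sums over them\<close>

lemma block_start_Suc: "block_start (Suc l) = block_start l + level_weight l"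
  by (simp add: block_start_def)

lemma block_start_mono: "k \<le> l \<Longrightarrow> block_start k \<le> block_start l"
  unfolding block_start_def by (rule sum_mono2) auto

lemma le_block_start: "l \<le> block_start l"
proof (induction l)
  case (Suc l)
  then show ?case using level_weight_ge_1[of l] by (simp add: block_start_Suc)
qed simp

lemma level_eq:
  assumes "block_start l \<le> t" "t < block_start (Suc l)"
  shows "level t = l"
  unfolding level_def
proof (rule Least_equality)
  show "l \<le> k" if "t < block_start (Suc k)" for k
    using that assms block_start_mono[of "Suc k" l] by (meson leD le_less_trans not_less_eq_eq)
qed fact

lemma less_block_start_level: "t < block_start (Suc (level t))"
  unfolding level_def by (rule LeastI[of _ t]) (use le_block_start[of "Suc t"] in simp)

lemma level_ge: "block_start l \<le> t \<Longrightarrow> l \<le> level t"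
  using less_block_start_level[of t] block_start_mono[of "Suc (level t)" l]
  by (meson leD le_less_trans not_less_eq_eq)

lemma level_le: "level t \<le> t"
  unfolding level_def by (rule Least_le) (use le_block_start[of "Suc t"] in simp)

lemma sum_level_blocks:
  fixes f :: "nat \<Rightarrow> real"
  shows "(\<Sum>t<block_start n. f (level t)) = (\<Sum>l<n. real (level_weight l) * f l)"
proof (induction n)
  case 0
  show ?case by (simp add: block_start_def)
next
  case (Suc n)
  have "(\<Sum>t<block_start (Suc n). f (level t)) =
      (\<Sum>t<block_start n. f (level t)) + (\<Sum>t=block_start n..<block_start (Suc n). f (level t))"
    using block_start_mono[of n "Suc n"]
    by (metis atLeast0LessThan le_add2 plus_1_eq_Suc sum.atLeastLessThan_concat zero_le)
  also have "(\<Sum>t=block_start n..<block_start (Suc n). f (level t)) =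
      (\<Sum>t=block_start n..<block_start (Suc n). f n)"
    by (rule sum.cong) (auto simp: level_eq)
  finally show ?case by (simp add: Suc.IH block_start_Suc)
qed

text \<open>Block \<open>l\<close> contributes \<open>Suc l / 2 ^ l\<close> in total, and partial
  sums are dominated by sums over whole blocks.\<close>

lemma summable_expected_risk: "summable (\<lambda>t. \<integral>i. risk (level t) i \<partial>level_pmf (level t))"
proof (rule summableI_nonneg_bounded[where x = 4])
  show "0 \<le> (\<integral>i. risk (level t) i \<partial>level_pmf (level t))" for t
    by (simp add: expectation_risk)
  fix n
  have "(\<Sum>t<n. \<integral>i. risk (level t) i \<partial>level_pmf (level t)) \<le>
      (\<Sum>t<block_start n. \<integral>i. risk (level t) i \<partial>level_pmf (level t))"
    using le_block_start[of n] by (intro sum_mono2) (auto simp: expectation_risk)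
  also have "\<dots> = (\<Sum>l<n. real (level_weight l) * (real (Suc l) / (2 ^ l * real (level_weight l))))"
    unfolding expectation_risk by (rule sum_level_blocks)
  also have "\<dots> = (\<Sum>l<n. real (Suc l) / 2 ^ l)"
  proof (rule sum.cong)
    fix l
    show "real (level_weight l) * (real (Suc l) / (2 ^ l * real (level_weight l))) = real (Suc l) / 2 ^ l"
      using level_weight_ge_1[of l] by (auto simp: field_simps)
  qed simp
  \<comment> \<open>Closed form of the partial sums, which exhibits the bound 4.\<close>
  also have "\<dots> = 4 - (real n + 2) * 2 / 2 ^ n"
  proof (induction n)
    case (Suc n)
    have "4 - (real n + 2) * 2 / 2 ^ n + real (Suc n) / 2 ^ n = 4 - (real (Suc n) + 2) * 2 / 2 ^ Suc n"
      by (simp add: field_simps)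
    then show ?case using Suc.IH by simp
  qed simp
  finally show "(\<Sum>t<n. \<integral>i. risk (level t) i \<partial>level_pmf (level t)) \<le> 4"
    by (rule order_trans) simp
qed

lemma sum_inverse_level_weight: "(\<Sum>t<block_start n. 1 / level_weight (level t)) = real n"
proof -
  have "(\<Sum>t<block_start n. 1 / level_weight (level t)) = (\<Sum>l<n. real (level_weight l) * (1 / level_weight l))"
    by (rule sum_level_blocks)
  also have "\<dots> = (\<Sum>l<n. 1)"
    by (rule sum.cong) (use level_weight_ge_1 in \<open>auto simp: Suc_le_eq\<close>)
  finally show ?thesis by simp
qed

text \<open>Every block adds exactly 1 to the sum of the reciprocal weights, so this sum diverges;
  \<open>1 - x \<le> exp (- x)\<close> turns divergence into a vanishing product.\<close>

lemma prod_level_weight_small: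
  fixes K :: nat
  assumes "0 < K" "0 < e"
  shows "\<exists>T'\<ge>T. (\<Prod>t\<in>{T..<T'}. 1 - 1 / level_weight (level t) / K) < e"
proof -
  let ?w = "\<lambda>t. 1 / real (level_weight (level t))"
  \<comment> \<open>The first \<open>n\<close> blocks sum to \<open>n\<close>, which must exceed
    \<open>- K * ln e\<close> even after the stages before \<open>T\<close> are discarded.\<close>
  obtain n :: nat where n: "(\<Sum>t<T. ?w t) - K * ln e < real n"
    using reals_Archimedean2 by blast
  define T' where "T' = max T (block_start n)"
  have w: "0 \<le> ?w t / K" "?w t / K \<le> 1" for t
    using assms(1) level_weight_ge_1[of "level t"]
    by (auto simp: divide_simps simp flip: of_nat_mult)
  have "real n = (\<Sum>t<block_start n. ?w t)"
    by (rule sum_inverse_level_weight[symmetric])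
  also have "\<dots> \<le> (\<Sum>t<T'. ?w t)"
    by (rule sum_mono2) (auto simp: T'_def)
  also have "\<dots> = (\<Sum>t<T. ?w t) + (\<Sum>t\<in>{T..<T'}. ?w t)"
    using sum.atLeastLessThan_concat[of 0 T T' ?w] by (simp add: T'_def atLeast0LessThan)
  finally have "- (\<Sum>t\<in>{T..<T'}. ?w t) < K * ln e" using n by linarith
  then have "(- (\<Sum>t\<in>{T..<T'}. ?w t)) / K < ln e"
    using assms(1) by (subst pos_divide_less_eq) (auto simp: mult.commute)
  then have lt: "- (\<Sum>t\<in>{T..<T'}. ?w t / K) < ln e"
    by (simp add: sum_divide_distrib)
  have "(\<Prod>t\<in>{T..<T'}. 1 - ?w t / K) \<le> (\<Prod>t\<in>{T..<T'}. exp (- (?w t / K)))"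
  proof (rule prod_mono)
    fix t
    show "0 \<le> 1 - ?w t / K \<and> 1 - ?w t / K \<le> exp (- (?w t / K))"
      using w[of t] exp_ge_add_one_self[of "- (?w t / K)"] by simp
  qed
  also have "\<dots> = exp (- (\<Sum>t\<in>{T..<T'}. ?w t / K))"
    by (simp add: exp_sum[symmetric] sum_negf)
  also have "\<dots> < e"
    using lt assms(2) by (metis exp_less_cancel_iff exp_ln)
  finally show ?thesis unfolding T'_def by (intro exI[of _ T']) (auto simp: T'_def)
qed

text \<open>
  Each of the \<open>N + 1\<close> values leads to some mode with conditional probability at least \<open>1 / K\<close>; by the
  pigeonhole principle two values share such a mode.
\<close>

lemma memory_collision:
  fixes Q :: "(nat \<times> 'm) pmf" and h :: "nat \<times> 'm \<Rightarrow> real"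
  assumes fst: "map_pmf fst Q = D" and Q: "set_pmf Q \<subseteq> UNIV \<times> B" and B: "finite B" "card B \<le> K" "K \<le> N"
    and h: "\<And>x. 0 \<le> h x" "\<And>x. h x \<le> 1" 
    and pair: "\<And>i i' m. i < i' \<Longrightarrow> i' \<le> N \<Longrightarrow> m \<in> B \<Longrightarrow> b \<le> pmf D i * h (i, m) + pmf D i' * h (i', m)"
  shows "b / K \<le> (\<integral>x. h x \<partial>Q)"
proof -
  have "B \<noteq> {}" using Q set_pmf_not_empty[of Q] by auto
  with B have K: "0 < K" by (metis card_gt_0_iff gr0I leD)
  have "\<exists>m\<in>B. pmf D i / K \<le> pmf Q (i, m)" for i
  proof (rule ccontr)
    assume "\<not> (\<exists>m\<in>B. pmf D i / K \<le> pmf Q (i, m))"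
    then have lt: "\<forall>m\<in>B. pmf Q (i, m) < pmf D i / K" by auto
    have "pmf D i = measure_pmf.prob Q (fst -` {i})" unfolding fst[symmetric] by (rule pmf_map)
    also have "\<dots> = measure_pmf.prob Q (Pair i ` B)"
      by (rule measure_pmf.finite_measure_eq_AE) (use Q in \<open>auto simp: AE_measure_pmf_iff\<close>)
    also have "\<dots> = (\<Sum>m\<in>B. pmf Q (i, m))"
      using B by (subst measure_measure_pmf_finite) (auto simp: sum.reindex inj_on_def)
    also have "\<dots> < (\<Sum>m\<in>B. pmf D i / K)"
      by (rule sum_strict_mono) (use B \<open>B \<noteq> {}\<close> lt in auto)
    also have "\<dots> \<le> pmf D i"
      using B K by (simp add: field_simps mult_right_mono)
    finally show False by simp
  qed
  then obtain \<mu> where \<mu>: "\<And>i. \<mu> i \<in> B" "\<And>i. pmf D i / K \<le> pmf Q (i, \<mu> i)" by metis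
  have "\<not> inj_on \<mu> {..N}"
  proof
    assume "inj_on \<mu> {..N}"
    then have "card {..N} \<le> card B" using B(1) \<mu>(1) by (intro card_inj_on_le) auto
    then show False using B by simp
  qed
  then obtain i i' where i: "i < i'" "i' \<le> N" "\<mu> i = \<mu> i'"
    by (auto simp: inj_on_def) (metis linorder_neqE_nat)
  have int: "integrable Q h"
    by (rule measure_pmf.integrable_const_bound[where B=1]) (use h in auto)
  \<comment> \<open>Only the two points with the shared mode are kept in the integral; the remainder
    is nonnegative.\<close>
  let ?I = "{(i, \<mu> i), (i', \<mu> i)}"
  have "b / K \<le> pmf D i / K * h (i, \<mu> i) + pmf D i' / K * h (i', \<mu> i)"
    using divide_right_mono[OF pair[OF i(1,2) \<mu>(1)[of i]], of K] by (simp add: add_divide_distrib)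
  also have "\<dots> \<le> pmf Q (i, \<mu> i) * h (i, \<mu> i) + pmf Q (i', \<mu> i) * h (i', \<mu> i)"
    using \<mu>(2)[of i] \<mu>(2)[of i'] h i by (intro add_mono mult_right_mono) auto
  also have "\<dots> = (\<Sum>x\<in>?I. h x * indicator ?I x * pmf Q x)"
    using i by (simp add: mult.commute)
  also have "\<dots> = (\<integral>x. h x * indicator ?I x \<partial>Q)"
    by (rule integral_measure_pmf_real[symmetric]) (auto simp: indicator_def split: if_splits)
  also have "\<dots> \<le> (\<integral>x. h x \<partial>Q)"
    by (rule integral_mono[OF _ int]) (use h in \<open>auto simp: indicator_def intro!: measure_pmf.integrable_const_bound[where B=1]\<close>)
  finally show ?thesis .
qed

section \<open>The game\<close>

text \<open>States are natural numbers, so the step number and the label are packed by the standard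
  pairing function.\<close>

abbreviation node :: "nat \<Rightarrow> nat \<Rightarrow> nat" where
  "node n x \<equiv> prod_encode (n, x)"

definition time :: "nat \<Rightarrow> nat" where
  "time s = fst (prod_decode s)"

definition label :: "nat \<Rightarrow> nat" where
  "label s = snd (prod_decode s)"

lemma time_node [simp]: "time (node n x) = n" and label_node [simp]: "label (node n x) = x"
  by (simp_all add: time_def label_def)

lemma node_time_label [simp]: "node (time s) (label s) = s"
  by (simp add: time_def label_def)

text \<open>
  A state is a step number with a label, and every layer is completely joined to the next one. Stage
  \<open>t\<close> consists of the steps \<open>4 * t, \<dots>, 4 * t + 3\<close>. From the first one a level \<open>i\<close> is drawn; it is
  the label of the second one, and earns \<open>i * fact (t + 2)\<close> on leaving it. The third one has a single
  controlled state, so \<open>i\<close> is not visible there; the controller picks the label \<open>j\<close> of the fourth one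
  and pays \<open>j * fact (t + 2) - 1\<close>. The next stage is entered with label 1 in case of a penalty, which
  has probability \<open>risk (level t) j\<close>, and with label 0 otherwise. The factorials make each single loss
  exceed everything earned before.
\<close>

definition labels :: "nat \<Rightarrow> nat set" where
  "labels n = (if n mod 4 = 0 then {0, 1} else if n mod 4 = 2 then {0} else {..level (n div 4)})"

definition next_label :: "nat \<Rightarrow> nat \<Rightarrow> nat pmf" where
  "next_label n x =
     (if n mod 4 = 0 then level_pmf (level (n div 4))
      else if n mod 4 = 3 then map_pmf of_bool (bernoulli_pmf (risk (level (n div 4)) x))
      else return_pmf 0)"

text \<open>The penalty at the end of stage \<open>t\<close> carries \<open>fact (t + 3)\<close>,
  because it has to outweigh the gain of the same stage as well as all earlier payoff.\<close>

definition stage_reward :: "nat \<Rightarrow> nat \<Rightarrow> nat \<Rightarrow> real" where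
  "stage_reward n x y =
     (if n mod 4 = 1 then x * fact (n div 4 + 2)
      else if n mod 4 = 2 then 1 - y * fact (n div 4 + 2)
      else if n mod 4 = 3 then - (y * fact (n div 4 + 3))
      else 0)"

definition game :: "nat mdp" where
  "game =
     \<lparr> controlled = {s. label s \<in> labels (time s) \<and> time s mod 4 = 2},
       random = {s. label s \<in> labels (time s) \<and> time s mod 4 \<noteq> 2},
       transitions = {(s, s'). label s \<in> labels (time s) \<and> label s' \<in> labels (time s') \<and>
                        time s' = Suc (time s)},
       rand_prob = (\<lambda>s. map_pmf (node (Suc (time s))) (next_label (time s) (label s))),
       reward = (\<lambda>(s, s'). stage_reward (time s) (label s) (label s')) \<rparr>"

lemma game_simps [simp]:
  "s \<in> controlled game \<longleftrightarrow> label s \<in> labels (time s) \<and> time s mod 4 = 2"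
  "s \<in> random game \<longleftrightarrow> label s \<in> labels (time s) \<and> time s mod 4 \<noteq> 2"
  "s \<in> states game \<longleftrightarrow> label s \<in> labels (time s)"
  "(s, s') \<in> transitions game \<longleftrightarrow>
     label s \<in> labels (time s) \<and> label s' \<in> labels (Suc (time s)) \<and> time s' = Suc (time s)"
  "rand_prob game s = map_pmf (node (Suc (time s))) (next_label (time s) (label s))"
  "reward game (s, s') = stage_reward (time s) (label s) (label s')"
  by (auto simp: game_def states_def)

lemma succs_game:
  "label s \<in> labels (time s) \<Longrightarrow> succs game s = node (Suc (time s)) ` labels (Suc (time s))"
  by (auto simp: succs_def image_iff) (metis node_time_label)

lemma labels_0: "0 \<in> labels n"
  by (simp add: labels_def)

lemma finite_labels: "finite (labels n)"
  by (simp add: labels_def)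

lemma set_next_label:
  assumes "n mod 4 \<noteq> 2"
  shows "set_pmf (next_label n x) \<subseteq> labels (Suc n)"
proof -
  consider "n mod 4 = 0" | "n mod 4 = 1" | "n mod 4 = 3" using assms by linarith
  then show ?thesis
  proof cases
    case 1
    then have "Suc n mod 4 = 1" "Suc n div 4 = n div 4" by presburger+
    then show ?thesis using 1 set_level_pmf by (simp add: next_label_def labels_def)
  next
    case 2
    then show ?thesis by (simp add: next_label_def labels_0)
  next
    case 3
    then have "Suc n mod 4 = 0" by presburger
    then show ?thesis using 3 by (auto simp: next_label_def labels_def)
  qed
qed

lemma is_mdp_game: "is_mdp game"
  unfolding is_mdp_def
proof (intro conjI ballI)
  show "succs game s \<noteq> {}" if "s \<in> states game" for s
    using that labels_0 by (auto simp: succs_game)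
  show "set_pmf (rand_prob game s) \<subseteq> succs game s" if "s \<in> random game" for s
    using that set_next_label[of "time s" "label s"] by (auto simp: succs_game)
qed auto

lemma finitely_branching_game: "finitely_branching game"
  by (auto simp: finitely_branching_def succs_game finite_labels)

text \<open>\<open>time\<close> grows strictly along every transition.\<close>

lemma acyclic_game: "acyclic (transitions game)"
proof (rule acyclic_subset)
  show "transitions game \<subseteq> inv_image less_than time" by auto
qed (simp add: wf_acyclic wf_inv_image)

lemma reward_game_Ints: "\<forall>e\<in>transitions game. reward game e \<in> \<int>"
  by (auto simp: stage_reward_def fact_in_Ints)

lemma partial_run_game_nth:
  "partial_run game h \<Longrightarrow> i < length h \<Longrightarrow>
     time (h ! i) = time (hd h) + i \<and> label (h ! i) \<in> labels (time (hd h) + i)"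
proof (induction i)
  case 0
  then have "h ! 0 \<in> states game"
    using nth_mem[of 0 h] by (auto simp: partial_run_def simp del: game_simps)
  then show ?case using 0 by (simp add: hd_conv_nth)
next
  case (Suc i)
  then have "(h ! i, h ! Suc i) \<in> transitions game"
    by (auto simp: partial_run_def successively_conv_nth)
  then have "time (h ! Suc i) = Suc (time (h ! i))" "label (h ! Suc i) \<in> labels (Suc (time (h ! i)))"
    by simp_all
  then show ?case using Suc by (metis Suc_lessD add_Suc_right)
qed

lemma step_counter_implicit_game: "step_counter_implicit game (node 0 0)"
proof -
  have "length h = Suc (time (last h))" if "partial_run game h" "hd h = node 0 0" for h
    using that partial_run_game_nth[of h "length h - 1"]
    by (cases "h = []") (auto simp: partial_run_def last_conv_nth)
  then show ?thesis unfolding step_counter_implicit_def by metis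
qed

section \<open>Payoff along a sequence of labels\<close>

definition payoff :: "(nat \<Rightarrow> nat) \<Rightarrow> nat \<Rightarrow> real" where
  "payoff x n = (\<Sum>j<n. stage_reward j (x j) (x (Suc j)))"

text \<open>All positions of a stage are covered, since the limit inferior sees every step: a choice
  \<open>j > i\<close> shows at \<open>4 * t + 3\<close>, a penalty at
  \<open>4 * t + 4\<close>.\<close>

lemma payoff_stage:
  "payoff x (4 * t + 1) = payoff x (4 * t)"
  "payoff x (4 * t + 2) = payoff x (4 * t) + real (x (4 * t + 1)) * fact (t + 2)"
  "payoff x (4 * t + 3) =
     payoff x (4 * t) + 1 + real (x (4 * t + 1)) * fact (t + 2) - real (x (4 * t + 3)) * fact (t + 2)"
  "payoff x (4 * t + 4) = payoff x (4 * t) + 1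
     + real (x (4 * t + 1)) * fact (t + 2) - real (x (4 * t + 3)) * fact (t + 2) - real (x (4 * t + 4)) * fact (t + 3)"
proof -
  have Suc: "payoff x (Suc n) = payoff x n + stage_reward n (x n) (x (Suc n))" for n
    by (simp add: payoff_def)
  have "4 * t mod 4 = 0" "(4 * t + 1) mod 4 = 1" "(4 * t + 2) mod 4 = 2" "(4 * t + 3) mod 4 = 3"
    "4 * t div 4 = t" "(4 * t + 1) div 4 = t" "(4 * t + 2) div 4 = t" "(4 * t + 3) div 4 = t"
    by presburger+
  note * = this
  have e: "4 * t + 2 = Suc (4 * t + 1)" "4 * t + 3 = Suc (4 * t + 2)" "4 * t + 4 = Suc (4 * t + 3)"
    by simp_all
  show 1: "payoff x (4 * t + 1) = payoff x (4 * t)"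
    using Suc[of "4 * t"] * by (simp add: stage_reward_def)
  show 2: "payoff x (4 * t + 2) = payoff x (4 * t) + real (x (4 * t + 1)) * fact (t + 2)"
    using Suc[of "4 * t + 1", folded e] * 1 by (simp add: stage_reward_def del: fact_Suc fact_2)
  show 3: "payoff x (4 * t + 3) =
     payoff x (4 * t) + 1 + real (x (4 * t + 1)) * fact (t + 2) - real (x (4 * t + 3)) * fact (t + 2)"
    using Suc[of "4 * t + 2", folded e] * 2
    by (simp add: stage_reward_def del: fact_Suc)
  show "payoff x (4 * t + 4) = payoff x (4 * t) + 1
     + real (x (4 * t + 1)) * fact (t + 2) - real (x (4 * t + 3)) * fact (t + 2) - real (x (4 * t + 4)) * fact (t + 3)"
    using Suc[of "4 * t + 3", folded e] * 3
    by (simp add: stage_reward_def del: fact_Suc)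
qed

lemma fact_add_3: "(fact (t + 3) :: real) = (real t + 3) * fact (t + 2)"
proof -
  have "t + 3 = Suc (t + 2)" by simp
  then have "(fact (t + 3) :: real) = real (Suc (t + 2)) * fact (t + 2)"
    by (metis fact_Suc)
  then show ?thesis by (simp add: algebra_simps)
qed

lemma labels_stage:
  "x \<in> labels (4 * t + 1) \<longleftrightarrow> x \<le> level t" "x \<in> labels (4 * t + 3) \<longleftrightarrow> x \<le> level t"
proof -
  have "(4 * t + 1) mod 4 = 1" "(4 * t + 3) mod 4 = 3" "(4 * t + 1) div 4 = t" "(4 * t + 3) div 4 = t"
    by presburger+
  then show "x \<in> labels (4 * t + 1) \<longleftrightarrow> x \<le> level t" "x \<in> labels (4 * t + 3) \<longleftrightarrow> x \<le> level t"
    by (simp_all add: labels_def)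
qed

context
  fixes x :: "nat \<Rightarrow> nat"
  assumes x: "\<And>n. x n \<in> labels n"
begin

lemma stage_gain_le: "real (x (4 * t + 1)) * fact (t + 2) \<le> real t * fact (t + 2)"
  using x[of "4 * t + 1"] level_le[of t] unfolding labels_stage
  by (intro mult_right_mono) auto

text \<open>A stage adds at most \<open>1 + t * fact (t + 2)\<close>, and
  \<open>fact (t + 3) = (t + 3) * fact (t + 2)\<close> has room for that. With the slack 2, a loss
  of \<open>fact (t + 2)\<close> leads to \<open>-1\<close> even after the bonus.\<close>

lemma stage_payoff_le: "payoff x (4 * t) \<le> fact (t + 2) - 2"
proof (induction t)
  case 0
  show ?case by (simp add: payoff_def)
next
  case (Suc t)
  have "0 \<le> real (x (4 * t + 3)) * fact (t + 2)" "0 \<le> real (x (4 * t + 4)) * fact (t + 3)"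
    by simp_all
  then have "payoff x (4 * t + 4) \<le> fact (t + 2) - 2 + 1 + real t * fact (t + 2)"
    using Suc.IH stage_gain_le[of t] payoff_stage(4)[of x t] by linarith
  also have "\<dots> \<le> fact (t + 3) - 2"
    using fact_ge_1[of "t + 2", where 'a = real] unfolding fact_add_3 distrib_right by linarith
  finally show ?case by (simp add: numeral_3_eq_3 add.commute mult_Suc_right del: fact_Suc)
qed

text \<open>A choice above the drawn level loses at least \<open>fact (t + 2)\<close> net of the
  gain, and a penalty at least \<open>fact (t + 3)\<close>. Reaching \<open>-1\<close>, and not just
  some negative value, keeps the limit inferior away from 0 if this happens infinitely
  often.\<close>

lemma bad_stage_negative:
  assumes "x (4 * t + 1) < x (4 * t + 3) \<or> x (4 * t + 4) \<noteq> 0"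
  shows "\<exists>n\<ge>t. payoff x n \<le> - 1"
proof (cases "x (4 * t + 1) < x (4 * t + 3)")
  case True
  then have "(real (x (4 * t + 1)) + 1) * fact (t + 2) \<le> real (x (4 * t + 3)) * fact (t + 2)"
    by (intro mult_right_mono) auto
  then have "payoff x (4 * t + 3) \<le> - 1"
    using stage_payoff_le[of t] payoff_stage(3)[of x t]
    unfolding distrib_right mult_1 by linarith
  then show ?thesis by (intro exI[of _ "4 * t + 3"]) auto
next
  case False
  with assms have "x (4 * t + 4) \<noteq> 0" by simp
  then have "1 * fact (t + 3) \<le> real (x (4 * t + 4)) * fact (t + 3)"
    by (intro mult_right_mono) auto
  moreover have "0 \<le> real (x (4 * t + 3)) * fact (t + 2)" by simp
  ultimately have "payoff x (4 * t + 4) \<le> fact (t + 2) - 2 + 1 + real t * fact (t + 2) - fact (t + 3)"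
    using stage_payoff_le[of t] stage_gain_le[of t] payoff_stage(4)[of x t]
    by linarith
  also have "\<dots> \<le> - 1"
    using fact_ge_1[of "t + 2", where 'a = real] unfolding fact_add_3 distrib_right by linarith
  finally show ?thesis by (intro exI[of _ "4 * t + 4"]) auto
qed

lemma liminf_payoff_imp_good:
  assumes "0 \<le> liminf (\<lambda>n. ereal (payoff x n))"
  shows "\<exists>T. \<forall>t\<ge>T. x (4 * t + 3) \<le> x (4 * t + 1) \<and> x (4 * t + 4) = 0"
proof -
  have "ereal (-1) < liminf (\<lambda>n. ereal (payoff x n))"
    using assms by (rule less_le_trans[rotated]) simp
  then have "eventually (\<lambda>n. ereal (-1) < ereal (payoff x n)) sequentially"
    by (rule less_LiminfD)
  then obtain T where "\<And>n. n \<ge> T \<Longrightarrow> - 1 < payoff x n"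
    by (auto simp: eventually_sequentially)
  then show ?thesis
    using bad_stage_negative by (meson leD le_trans linorder_not_less)
qed

text \<open>Gain and cost of a matched stage cancel. From stage \<open>T\<close> on each stage thus
  adds its bonus 1, and the payoff inside a stage never falls below its value at the start.\<close>

lemma liminf_payoff_matched:
  assumes match: "\<And>t. x (4 * t + 3) = x (4 * t + 1)"
    and risk: "\<And>t. T \<le> t \<Longrightarrow> x (4 * t + 4) = 0"
  shows "0 \<le> liminf (\<lambda>n. ereal (payoff x n))"
proof -
  have ge: "payoff x (4 * T) + real k \<le> payoff x (4 * (T + k))" for k
  proof (induction k)
    case (Suc k)
    then show ?case
      using payoff_stage(4)[of x "T + k"] match[of "T + k"] risk[of "T + k"]
      by (simp add: add.commute add_mult_distrib2)
  qed simp
  \<comment> \<open>After \<open>k\<close> further stages the bonuses have compensated whatever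
    deficit stage \<open>T\<close> began with.\<close>
  obtain k where k: "- payoff x (4 * T) < real k" using reals_Archimedean2 by blast
  have "0 \<le> payoff x n" if n: "4 * (T + k) \<le> n" for n
  proof -
    define t where "t = n div 4"
    have t: "T + k \<le> t" using n unfolding t_def by presburger
    have "0 \<le> payoff x (4 * t)"
      using ge[of "t - T"] t k by (simp add: of_nat_diff)
    moreover have "n = 4 * t \<or> n = 4 * t + 1 \<or> n = 4 * t + 2 \<or> n = 4 * t + 3"
      unfolding t_def by presburger
    ultimately show ?thesis
      using payoff_stage[of x t] match[of t] by (auto simp del: fact_Suc)
  qed
  then have "eventually (\<lambda>n. 0 \<le> ereal (payoff x n)) sequentially"
    by (auto simp: eventually_sequentially)
  then show ?thesis by (rule Liminf_bounded)
qed

end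

lemma TP_liminf_ge0_game:
  "\<omega> \<in> TP_liminf_ge0 game \<longleftrightarrow> \<omega> \<in> runs game \<and>
     0 \<le> liminf (\<lambda>n. ereal (\<Sum>j<n. stage_reward (time (\<omega> j)) (label (\<omega> j)) (label (\<omega> (Suc j)))))"
  by (simp add: TP_liminf_ge0_def)

lemma runs_game:
  assumes "\<omega> \<in> runs game" "\<omega> 0 = node 0 0"
  shows "time (\<omega> n) = n \<and> label (\<omega> n) \<in> labels n"
proof (induction n)
  case 0
  show ?case using assms labels_0 by simp
next
  case (Suc n)
  have "(\<omega> n, \<omega> (Suc n)) \<in> transitions game" using assms by (auto simp: runs_def)
  then show ?case using Suc by simp
qed

lemma TP_liminf_ge0_game_iff:
  assumes "\<omega> 0 = node 0 0"
  shows "\<omega> \<in> TP_liminf_ge0 game \<longleftrightarrow>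
    \<omega> \<in> runs game \<and> 0 \<le> liminf (\<lambda>n. ereal (payoff (\<lambda>n. label (\<omega> n)) n))"
  using runs_game[where \<omega> = \<omega>] assms by (auto simp: TP_liminf_ge0_game payoff_def)

section \<open>Boundedly many modes\<close>

text \<open>The new mode may be correlated with the label drawn at a random state, but it cannot
  change the law of that label.\<close>

lemma random_step_label:
  assumes mem: "is_memory game A \<tau>" and m: "m \<in> A"
    and x: "x \<in> labels n" and n: "n mod 4 \<noteq> 2"
  shows "map_pmf (\<lambda>y. label (snd y)) (\<tau> (m, node n x)) = next_label n x"
proof -
  have "map_pmf snd (\<tau> (m, node n x)) = rand_prob game (node n x)"
    using mem m x n unfolding is_memory_def by simp
  then have "map_pmf label (map_pmf snd (\<tau> (m, node n x))) = next_label n x"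
    by (simp add: map_pmf_comp)
  then show ?thesis by (simp add: map_pmf_comp)
qed

lemma prob_next_label_risk:
  "measure_pmf.prob (next_label (4 * t + 3) j) {a. a \<noteq> 0} = risk (level t) j"
proof -
  have "(4 * t + 3) mod 4 = 3" "(4 * t + 3) div 4 = t" by presburger+
  moreover have "of_bool -` {a :: nat. a \<noteq> 0} = {True}" by auto
  ultimately show ?thesis by (simp add: next_label_def measure_pmf_single risk_bounds)
qed

text \<open>The four positions after the start of a stage: \<open>y1\<close> shows the drawn level,
  \<open>y2\<close> retains it only through its mode, \<open>y3\<close> shows the choice and
  \<open>y4\<close> the penalty.\<close>

definition stage_pmf ::
  "('m \<times> nat \<Rightarrow> ('m \<times> nat) pmf) \<Rightarrow> 'm \<times> nat \<Rightarrow> (('m \<times> nat) \<times> ('m \<times> nat) \<times> ('m \<times> nat) \<times> ('m \<times> nat)) pmf" where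
  "stage_pmf \<tau> z = bind_pmf (\<tau> z) (\<lambda>y1. bind_pmf (\<tau> y1) (\<lambda>y2. bind_pmf (\<tau> y2)
     (\<lambda>y3. map_pmf (\<lambda>y4. (y1, y2, y3, y4)) (\<tau> y3))))"

lemma chain_pmf_stage:
  "chain_pmf \<tau> z (4 * Suc t) =
     bind_pmf (chain_pmf \<tau> z (4 * t))
       (\<lambda>w. map_pmf (\<lambda>(y1, y2, y3, y4). w @ [y1, y2, y3, y4]) (stage_pmf \<tau> (last w)))"
proof -
  have "4 * Suc t = Suc (Suc (Suc (Suc (4 * t))))" by simp
  then show ?thesis
    by (simp only: chain_pmf.simps stage_pmf_def)
       (simp add: bind_assoc_pmf map_bind_pmf bind_map_pmf map_pmf_comp)
qed

text \<open>Instance of \<open>memory_collision\<close>: \<open>Q\<close> is the joint law of the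
  drawn level and the position \<open>y2\<close>, and \<open>h\<close> is the conditional
  probability that the stage turns out bad.\<close>

lemma stage_bad_ge:
  assumes mem: "is_memory game A \<tau>" and m: "m \<in> A" and x: "x \<in> labels (4 * t)"
    and B: "\<And>y1 y2. y1 \<in> set_pmf (\<tau> (m, node (4 * t) x)) \<Longrightarrow> y2 \<in> set_pmf (\<tau> y1) \<Longrightarrow> fst y2 \<in> B"
    and card: "finite B" "card B \<le> K" "K \<le> level t"
  shows "1 / real (level_weight (level t)) / K \<le> measure_pmf.prob (stage_pmf \<tau> (m, node (4 * t) x))
     {(y1, y2, y3, y4). label (snd y1) < label (snd y3) \<or> label (snd y4) \<noteq> 0}"
proof -
  let ?z = "(m, node (4 * t) x)"
  let ?l = "level t"
  have mod: "4 * t mod 4 \<noteq> 2" "(4 * t + 1) mod 4 \<noteq> 2" "(4 * t + 3) mod 4 \<noteq> 2" by presburger+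
  have set\<tau>: "fst y \<in> A \<and> time (snd y) = Suc n \<and> label (snd y) \<in> labels (Suc n)"
    if "y \<in> set_pmf (\<tau> (m', node n x'))" "m' \<in> A" "x' \<in> labels n" for y m' n x'
    using that mem unfolding is_memory_def by (fastforce simp: succs_game)
  define D where "D = level_pmf ?l"
  define Q where "Q = bind_pmf (\<tau> ?z) (\<lambda>y1. map_pmf (\<lambda>y2. (label (snd y1), y2)) (\<tau> y1))"
  define g where "g i y3 = measure_pmf.prob (\<tau> y3) {y4. i < label (snd y3) \<or> label (snd y4) \<noteq> 0}"
    for i and y3 :: "'a \<times> nat"
  define h where "h = (\<lambda>(i, y2). \<integral>y3. g i y3 \<partial>\<tau> y2)"
  have g01: "0 \<le> g i y" "g i y \<le> 1" for i y by (auto simp: g_def)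
  have g_int: "integrable (\<tau> y2) (g i)" for i y2
    by (rule measure_pmf.integrable_const_bound[where B = 1]) (auto simp: g01)
  have y1: "fst y1 \<in> A \<and> time (snd y1) = 4 * t + 1 \<and> label (snd y1) \<in> labels (4 * t + 1)"
    if "y1 \<in> set_pmf (\<tau> ?z)" for y1
    using set\<tau>[OF that m x] by simp
  have y2: "fst y2 \<in> A \<inter> B \<and> snd y2 = node (4 * t + 2) 0"
    if "y1 \<in> set_pmf (\<tau> ?z)" "y2 \<in> set_pmf (\<tau> y1)" for y1 y2
  proof -
    have "y1 = (fst y1, node (4 * t + 1) (label (snd y1)))"
      using y1[OF that(1)] by (metis node_time_label prod.collapse)
    then have "fst y2 \<in> A \<and> time (snd y2) = 4 * t + 2 \<and> label (snd y2) \<in> labels (4 * t + 2)"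
      using set\<tau>[of y2 "fst y1" "4 * t + 1" "label (snd y1)"] that y1[OF that(1)] by simp
    moreover have "(4 * t + 2) mod 4 = 2" by presburger
    ultimately show ?thesis
      using B[OF that] node_time_label[of "snd y2"] by (simp add: labels_def)
  qed
  have "1 / real (level_weight ?l) / K \<le> (\<integral>q. h q \<partial>Q)"
  proof (rule memory_collision)
    have "map_pmf fst Q = map_pmf (\<lambda>y1. label (snd y1)) (\<tau> ?z)"
      by (simp add: Q_def map_bind_pmf map_pmf_comp flip: map_pmf_def)
    then show "map_pmf fst Q = D"
      using random_step_label[OF mem m x mod(1)] by (simp add: next_label_def D_def)
    \<comment> \<open>The third step has a single state, so \<open>y2\<close> takes at most as many
      values as there are modes in \<open>B\<close>.\<close>
    show "set_pmf Q \<subseteq> UNIV \<times> (A \<inter> B) \<times> {node (4 * t + 2) 0}"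
      using y2 by (fastforce simp: Q_def)
    show "finite ((A \<inter> B) \<times> {node (4 * t + 2) 0})" using card by simp
    show "card ((A \<inter> B) \<times> {node (4 * t + 2) 0}) \<le> K"
      using card card_mono[of B "A \<inter> B"] by (simp add: card_cartesian_product)
    show "K \<le> ?l" by fact
    show "0 \<le> h q" for q by (auto simp: h_def g01 integral_nonneg_AE split: prod.split)
    show "h q \<le> 1" for q
      by (auto simp: h_def g01 intro!: measure_pmf.integral_le_const g_int split: prod.split)
    fix i i' and y :: "'a \<times> nat"
    assume i: "i < i'" "i' \<le> ?l" and "y \<in> (A \<inter> B) \<times> {node (4 * t + 2) 0}"
    then obtain m' where y: "y = (m', node (4 * t + 2) 0)" "m' \<in> A" by auto
    have "1 / real (level_weight ?l) \<le> pmf D i * g i y3 + pmf D i' * g i' y3"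
      if y3: "y3 \<in> set_pmf (\<tau> y)" for y3
    proof -
      have "fst y3 \<in> A \<and> time (snd y3) = 4 * t + 3 \<and> label (snd y3) \<in> labels (4 * t + 3)"
        using set\<tau>[of y3 m' "4 * t + 2" 0] y3 y labels_0 by (simp add: eval_nat_numeral)
      then obtain m3 j where y3': "y3 = (m3, node (4 * t + 3) j)" "m3 \<in> A" "j \<in> labels (4 * t + 3)"
        by (metis node_time_label prod.collapse)
      have g: "g k y3 = (if k < j then 1 else risk ?l j)" for k
      proof (cases "k < j")
        case False
        have "g k y3 = measure_pmf.prob (map_pmf (\<lambda>y. label (snd y)) (\<tau> y3)) {a. a \<noteq> 0}"
          using False by (simp add: g_def y3' vimage_def)
        also have "\<dots> = measure_pmf.prob (next_label (4 * t + 3) j) {a. a \<noteq> 0}"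
          using random_step_label[OF mem y3'(2,3) mod(3)] by (simp add: y3')
        also have "\<dots> = risk ?l j" by (rule prob_next_label_risk)
        finally show ?thesis using False by simp
      qed (simp add: g_def y3')
      \<comment> \<open>A choice above \<open>i\<close> is bad for certain if \<open>i\<close> was
        drawn; otherwise it lies below \<open>i'\<close> and is too risky if \<open>i'\<close> was
        drawn.\<close>
      consider "i < j" | "j \<le> i" by linarith
      then show ?thesis
      proof cases
        case 1
        have "1 / real (level_weight ?l) \<le> pmf D i * 1 + 0"
          using level_pmf_ge[of i ?l] i by (simp add: D_def)
        also have "\<dots> \<le> pmf D i * g i y3 + pmf D i' * g i' y3"
          using 1 g01[of i' y3] by (intro add_mono) (auto simp: g)
        finally show ?thesis .
      next
        case 2
        have "1 / real (level_weight ?l) \<le> 0 + pmf D i' * risk ?l j"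
          using level_pmf_risk_ge[of j i' ?l] i 2 by (simp add: D_def)
        also have "\<dots> \<le> pmf D i * g i y3 + pmf D i' * g i' y3"
          using 2 i g01[of i y3] by (intro add_mono) (auto simp: g)
        finally show ?thesis .
      qed
    qed
    then have "1 / real (level_weight ?l) \<le> (\<integral>y3. pmf D i * g i y3 + pmf D i' * g i' y3 \<partial>\<tau> y)"
      by (intro measure_pmf.integral_ge_const) (auto simp: AE_measure_pmf_iff g_int)
    also have "\<dots> = pmf D i * h (i, y) + pmf D i' * h (i', y)"
      by (simp add: h_def g_int)
    finally show "1 / real (level_weight ?l) \<le> pmf D i * h (i, y) + pmf D i' * h (i', y)" .
  qed
  also have "(\<integral>q. h q \<partial>Q) = measure_pmf.prob (bind_pmf Q (\<lambda>(i, y2). bind_pmf (\<tau> y2)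
      (\<lambda>y3. map_pmf (\<lambda>y4. (i, y3, y4)) (\<tau> y3)))) {(i, y3, y4). i < label (snd y3) \<or> label (snd y4) \<noteq> 0}"
    by (simp add: prob_bind_pmf[of Q] h_def g_def prob_bind_pmf vimage_def split_def)
  also have "bind_pmf Q (\<lambda>(i, y2). bind_pmf (\<tau> y2) (\<lambda>y3. map_pmf (\<lambda>y4. (i, y3, y4)) (\<tau> y3))) =
      map_pmf (\<lambda>(y1, y2, y3, y4). (label (snd y1), y3, y4)) (stage_pmf \<tau> ?z)"
    by (simp add: Q_def stage_pmf_def bind_assoc_pmf bind_map_pmf map_bind_pmf map_pmf_comp)
  also have "measure_pmf.prob (map_pmf (\<lambda>(y1, y2, y3, y4). (label (snd y1), y3, y4)) (stage_pmf \<tau> ?z))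
        {(i, y3, y4). i < label (snd y3) \<or> label (snd y4) \<noteq> 0} =
      measure_pmf.prob (stage_pmf \<tau> ?z)
        {(y1, y2, y3, y4). label (snd y1) < label (snd y3) \<or> label (snd y4) \<noteq> 0}"
    by (simp add: vimage_def split_def)
  finally show ?thesis .
qed

text \<open>Only positions up to \<open>4 * T'\<close> are inspected, so a prefix of length
  \<open>Suc (4 * T')\<close> decides membership.\<close>

definition good_stages :: "nat \<Rightarrow> nat \<Rightarrow> nat list set" where
  "good_stages T T' = {h. \<forall>t\<in>{T..<T'}.
     label (h ! (4 * t + 3)) \<le> label (h ! (4 * t + 1)) \<and> label (h ! (4 * t + 4)) = 0}"

text \<open>\<open>A\<close> may be infinite; \<open>B n\<close> bounds the modes occurring at step
  \<open>n\<close>, with one \<open>K\<close> for all steps. Finite memory takes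
  \<open>B n = A\<close>; a clock with bits takes the modes whose clock shows
  \<open>n\<close>.\<close>

locale bounded_memory =
  fixes A :: "'m set" and \<tau> and m0 :: 'm and B :: "nat \<Rightarrow> 'm set" and K :: nat and \<sigma>
  assumes mem: "is_memory game A \<tau>" and m0: "m0 \<in> A" "m0 \<in> B 0"
    and imp: "implements game (node 0 0) \<tau> m0 \<sigma>"
    and B: "\<And>n. finite (B n)" "\<And>n. card (B n) \<le> K"
    and B_step: "\<And>n m x y. m \<in> A \<Longrightarrow> m \<in> B n \<Longrightarrow> x \<in> labels n \<Longrightarrow> y \<in> set_pmf (\<tau> (m, node n x)) \<Longrightarrow>
      fst y \<in> B (Suc n)"
begin

lemma K_pos: "0 < K"
  using m0(2) B[of 0] by (metis card_gt_0_iff empty_iff gr0I le_zero_eq)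

lemma chain_support:
  assumes "w \<in> set_pmf (chain_pmf \<tau> (m0, node 0 0) n)"
  shows "length w = Suc n \<and> fst (last w) \<in> A \<inter> B n \<and> time (snd (last w)) = n \<and>
    label (snd (last w)) \<in> labels n"
  using assms
proof (induction n arbitrary: w)
  case 0
  then show ?case using m0 labels_0 by simp
next
  case (Suc n)
  then obtain v y where v: "v \<in> set_pmf (chain_pmf \<tau> (m0, node 0 0) n)"
    and y: "y \<in> set_pmf (\<tau> (last v))" and w: "w = v @ [y]"
    by auto
  obtain m x where lv: "last v = (m, node n x)" "m \<in> A" "m \<in> B n" "x \<in> labels n"
    using Suc.IH[OF v] by (metis IntE node_time_label prod.collapse)
  have "set_pmf (\<tau> (m, node n x)) \<subseteq> A \<times> succs game (node n x)"
    using lv by (intro is_memory_set_pmf[OF mem]) auto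
  then have "y \<in> A \<times> node (Suc n) ` labels (Suc n)"
    using y lv by (auto simp: succs_game)
  then show ?case
    using B_step[OF lv(2-4), of y] y lv Suc.IH[OF v] by (auto simp: w)
qed

text \<open>Whatever happened before, each stage from \<open>T\<close> on is bad with probability at
  least the bound of \<open>stage_bad_ge\<close>; the complementary factors multiply.\<close>

lemma prob_good_stages_le:
  assumes T: "\<And>t. T \<le> t \<Longrightarrow> K \<le> level t" and "T \<le> T'"
  shows "measure_pmf.prob (chain_pmf \<tau> (m0, node 0 0) (4 * T')) {w. map snd w \<in> good_stages T T'} \<le>
    (\<Prod>t\<in>{T..<T'}. 1 - 1 / real (level_weight (level t)) / K)"
  using \<open>T \<le> T'\<close>
proof (induction T' rule: dec_induct)
  case base
  show ?case by simp
next
  case (step t)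
  let ?P = "chain_pmf \<tau> (m0, node 0 0)"
  let ?c = "1 - 1 / real (level_weight (level t)) / K"
  let ?good = "{(y1, y2, y3, y4). label (snd y3) \<le> label (snd y1) \<and> label (snd y4) = 0}"
  have c: "0 \<le> ?c"
    using K_pos level_weight_ge_1[of "level t"] by (auto simp: divide_simps simp flip: of_nat_mult)
  have "measure_pmf.prob (?P (4 * Suc t)) {w. map snd w \<in> good_stages T (Suc t)} \<le>
      ?c * measure_pmf.prob (?P (4 * t)) {w. map snd w \<in> good_stages T t}"
    unfolding chain_pmf_stage
  proof (rule prob_bind_pmf_le)
    fix w assume w: "w \<in> set_pmf (?P (4 * t))"
    have len: "length w = 4 * t + 1" using chain_support[OF w] by simp
    obtain m x where lw: "last w = (m, node (4 * t) x)" "m \<in> A" "m \<in> B (4 * t)" "x \<in> labels (4 * t)"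
      using chain_support[OF w] by (metis IntE node_time_label prod.collapse)
    have iff: "map snd (w @ [y1, y2, y3, y4]) \<in> good_stages T (Suc t) \<longleftrightarrow>
        map snd w \<in> good_stages T t \<and> label (snd y3) \<le> label (snd y1) \<and> label (snd y4) = 0"
      for y1 y2 y3 y4
    proof -
      have "{T..<Suc t} = insert t {T..<t}" using step by auto
      then show ?thesis
        by (auto simp: good_stages_def nth_append len)
    qed
    have "measure_pmf.prob (stage_pmf \<tau> (last w)) ?good =
        1 - measure_pmf.prob (stage_pmf \<tau> (last w)) (- ?good)"
      using measure_pmf.prob_compl[of ?good "stage_pmf \<tau> (last w)"] by (simp add: Compl_eq_Diff_UNIV)
    also have "- ?good = {(y1, y2, y3, y4). label (snd y1) < label (snd y3) \<or> label (snd y4) \<noteq> 0}"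
      by auto
    also have "1 - measure_pmf.prob (stage_pmf \<tau> (last w)) \<dots> \<le> ?c"
    proof -
      have "fst y2 \<in> B (Suc (Suc (4 * t)))"
        if "y1 \<in> set_pmf (\<tau> (m, node (4 * t) x))" "y2 \<in> set_pmf (\<tau> y1)" for y1 y2
      proof -
        have y1: "y1 \<in> A \<times> node (Suc (4 * t)) ` labels (Suc (4 * t))"
          using that(1) mem lw unfolding is_memory_def by (fastforce simp: succs_game)
        then show ?thesis
          using B_step[OF lw(2-4) that(1)] B_step[of "fst y1" "Suc (4 * t)" "label (snd y1)" y2] that(2)
          by auto
      qed
      from stage_bad_ge[OF mem lw(2,4) this B T] step show ?thesis
        by (simp add: lw(1))
    qed
    finally have "measure_pmf.prob (stage_pmf \<tau> (last w)) ?good \<le> ?c" .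
    then show "measure_pmf.prob (map_pmf (\<lambda>(y1, y2, y3, y4). w @ [y1, y2, y3, y4]) (stage_pmf \<tau> (last w)))
        {w. map snd w \<in> good_stages T (Suc t)} \<le> ?c * indicator {w. map snd w \<in> good_stages T t} w"
      using iff by (auto simp: vimage_def split_def indicator_def simp del: map_append)
  qed
  also have "\<dots> \<le> ?c * (\<Prod>t\<in>{T..<t}. 1 - 1 / real (level_weight (level t)) / K)"
    using step.IH c by (rule mult_left_mono)
  finally show ?case using step by (simp add: mult.commute)
qed

lemma AE_not_good_stages:
  assumes T: "\<And>t. T \<le> t \<Longrightarrow> K \<le> level t"
  shows "AE \<omega> in run_measure game \<sigma> (node 0 0). \<exists>T'. map \<omega> [0..<Suc (4 * T')] \<notin> good_stages T T'"
proof -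
  let ?R = "run_measure game \<sigma> (node 0 0)"
  interpret prob_space ?R by (rule prob_space_run_measure)
  define E where "E T' = {\<omega>. map \<omega> [0..<Suc (4 * T')] \<in> good_stages T T'}" for T'
  have E [measurable]: "E T' \<in> sets ?R" for T'
    unfolding E_def by (rule sets_prefix_event)
  then have Int: "(\<Inter>T'. E T') \<in> sets ?R" by blast
  \<comment> \<open>The bound for the chain passes to \<open>\<sigma>\<close>, whose prefixes are
    the state components of the chain.\<close>
  have small: "measure ?R (E T') \<le> (\<Prod>t\<in>{T..<T'}. 1 - 1 / real (level_weight (level t)) / K)" if "T \<le> T'" for T'
    unfolding E_def measure_prefix_event
    using prob_good_stages_le[OF T that] map_snd_chain_pmf[OF mem is_mdp_game m0(1) _ imp, of "4 * T'", symmetric]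
      labels_0[of 0]
    by (simp add: vimage_def)
  have "measure ?R (\<Inter>T'. E T') \<le> e" if e: "0 < e" for e
  proof -
    obtain T' where T': "T \<le> T'" "(\<Prod>t\<in>{T..<T'}. 1 - 1 / real (level_weight (level t)) / K) < e"
      using prod_level_weight_small[OF K_pos e] by blast
    have "measure ?R (\<Inter>T'. E T') \<le> measure ?R (E T')"
      by (rule finite_measure_mono) (auto simp: E)
    then show ?thesis using small[OF T'(1)] T'(2) by linarith
  qed
  then have "measure ?R (\<Inter>T'. E T') \<le> 0"
    by (rule field_le_epsilon) simp
  then have "measure ?R (\<Inter>T'. E T') = 0"
    by (simp add: measure_le_0_iff)
  then have "(\<Inter>T'. E T') \<in> null_sets ?R"
    using Int by (simp add: null_sets_def emeasure_eq_measure)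
  then show ?thesis
    by (rule AE_I') (auto simp: E_def simp del: upt_Suc)
qed

lemma measure_TP_eq_0: "measure (run_measure game \<sigma> (node 0 0)) (TP_liminf_ge0 game) = 0"
proof -
  let ?R = "run_measure game \<sigma> (node 0 0)"
  interpret prob_space ?R by (rule prob_space_run_measure)
  \<comment> \<open>From this stage on \<open>level t\<close> is at least \<open>K\<close>, so there
    are more levels to draw than modes.\<close>
  let ?S = "block_start K"
  have "AE \<omega> in ?R. \<forall>T. ?S \<le> T \<longrightarrow> (\<exists>T'. map \<omega> [0..<Suc (4 * T')] \<notin> good_stages T T')"
  proof (subst AE_all_countable, intro allI AE_impI AE_not_good_stages)
    show "K \<le> level t" if "?S \<le> T" "T \<le> t" for T t
      using that by (intro level_ge) simp
  qed
  moreover have "AE \<omega> in ?R. \<omega> 0 = node 0 0"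
    using AE_prefix[of game \<sigma> "node 0 0"]
  proof (rule AE_mp, intro AE_I2 impI)
    fix \<omega> assume "\<forall>n. map \<omega> [0..<Suc n] \<in> set_pmf (prefix_pmf game \<sigma> (node 0 0) n)"
    from spec[OF this, of 0] show "\<omega> 0 = node 0 0" by simp
  qed
  ultimately have "AE \<omega> in ?R. \<omega> \<notin> TP_liminf_ge0 game"
  proof eventually_elim
    case (elim \<omega>)
    show ?case
    proof
      assume "\<omega> \<in> TP_liminf_ge0 game"
      then have "\<omega> \<in> runs game" "0 \<le> liminf (\<lambda>n. ereal (payoff (\<lambda>n. label (\<omega> n)) n))"
        using TP_liminf_ge0_game_iff elim(2) by auto
      then obtain T where T: "\<And>t. T \<le> t \<Longrightarrow>
          label (\<omega> (4 * t + 3)) \<le> label (\<omega> (4 * t + 1)) \<and> label (\<omega> (4 * t + 4)) = 0"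
        using liminf_payoff_imp_good[of "\<lambda>n. label (\<omega> n)"] runs_game[where \<omega> = \<omega>] elim(2) by auto
      \<comment> \<open>A run satisfying the objective is good from some stage on, and this stage
        may be moved beyond \<open>?S\<close>.\<close>
      have "map \<omega> [0..<Suc (4 * T')] \<in> good_stages (max T ?S) T'" for T'
        using T by (auto simp: good_stages_def nth_map simp del: upt_Suc)
      then show False using elim(1) by (meson max.cobounded2)
    qed
  qed
  then show ?thesis
    by (subst (asm) AE_iff_null_sets[symmetric, OF sets_TP_liminf_ge0]) (auto simp: measure_eq_0_null_sets)
qed

end

section \<open>The two classes of strategies\<close>

lemma FR_measure_TP_eq_0:
  assumes "FR_strategy game (node 0 0) \<sigma>"
  shows "measure (run_measure game \<sigma> (node 0 0)) (TP_liminf_ge0 game) = 0"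
proof -
  obtain A :: "nat set" and m0 \<tau> where *: "finite A" "m0 \<in> A" "is_memory game A \<tau>"
    "implements game (node 0 0) \<tau> m0 \<sigma>"
    using assms unfolding FR_strategy_def by blast
  interpret bounded_memory A \<tau> m0 "\<lambda>_. A" "card A" \<sigma>
  proof
    fix m y and n x :: nat
    assume "m \<in> A" "x \<in> labels n" "y \<in> set_pmf (\<tau> (m, node n x))"
    moreover from this have "set_pmf (\<tau> (m, node n x)) \<subseteq> A \<times> succs game (node n x)"
      by (intro is_memory_set_pmf[OF *(3)]) auto
    ultimately show "fst y \<in> A" by auto
  qed (use * in auto)
  show ?thesis by (rule measure_TP_eq_0)
qed

text \<open>At step \<open>n\<close> the clock can only show \<open>n\<close>, which leaves
  \<open>2 ^ k\<close> modes.\<close>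

lemma k_bit_Markov_measure_TP_eq_0:
  assumes "k_bit_Markov_strategy k game (node 0 0) \<sigma>"
  shows "measure (run_measure game \<sigma> (node 0 0)) (TP_liminf_ge0 game) = 0"
proof -
  let ?L = "{b :: bool list. length b = k}"
  obtain b0 :: "bool list" and \<tau> where b0: "length b0 = k"
    and mem: "is_memory game (UNIV \<times> ?L) \<tau>"
    and clock: "\<And>(n :: nat) b s. s \<in> states game \<Longrightarrow> length b = k \<Longrightarrow>
      \<forall>((n', b'), s') \<in> set_pmf (\<tau> ((n, b), s)). n' = Suc n"
    and imp: "implements game (node 0 0) \<tau> (0, b0) \<sigma>"
    using assms unfolding k_bit_Markov_strategy_def by blast
  have L: "finite ?L" "card ?L = 2 ^ k"
    using finite_lists_length_eq[of "UNIV :: bool set" k] card_lists_length_eq[of "UNIV :: bool set" k]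
    by auto
  interpret bounded_memory "UNIV \<times> ?L" \<tau> "(0, b0)" "\<lambda>n. {n} \<times> ?L" "2 ^ k" \<sigma>
  proof
    fix m y and n x :: nat
    assume m: "m \<in> UNIV \<times> ?L" "m \<in> {n} \<times> ?L" and x: "x \<in> labels n"
      and y: "y \<in> set_pmf (\<tau> (m, node n x))"
    have "set_pmf (\<tau> (m, node n x)) \<subseteq> (UNIV \<times> ?L) \<times> succs game (node n x)"
      using m x by (intro is_memory_set_pmf[OF mem]) auto
    moreover have "fst (fst y) = Suc n"
      using bspec[OF clock[of "node n x" "snd m" n], of y] m x y by (auto simp: case_prod_beta)
    ultimately show "fst y \<in> {Suc n} \<times> ?L" using y by auto
  qed (use b0 mem imp L in \<open>auto simp: card_cartesian_product\<close>)
  show ?thesis by (rule measure_TP_eq_0)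
qed


section \<open>Perfect recall\<close>

text \<open>At the third step of a stage, the state before the last one still shows the drawn level,
  which is copied. The default 0 serves histories of length 1, which \<open>is_strategy\<close>
  includes because partial runs may start anywhere.\<close>

definition matching_strategy :: "nat list \<Rightarrow> nat pmf" where
  "matching_strategy h = return_pmf (node (Suc (time (last h)))
     (if 2 \<le> length h then label (h ! (length h - 2)) else 0))"

lemma is_strategy_matching: "is_strategy game matching_strategy"
  unfolding is_strategy_def
proof (intro allI impI)
  fix h assume h: "partial_run game h \<and> last h \<in> controlled game"
  let ?x = "if 2 \<le> length h then label (h ! (length h - 2)) else 0"
  have mod: "time (last h) mod 4 = 2" and lab: "label (last h) \<in> labels (time (last h))"
    using h by auto
  have "?x \<in> labels (Suc (time (last h)))"
  proof (cases "2 \<le> length h")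
    case True
    then have "(h ! (length h - 2), h ! Suc (length h - 2)) \<in> transitions game"
      using h by (auto simp: partial_run_def successively_conv_nth simp del: game_simps)
    moreover have "last h = h ! Suc (length h - 2)"
    proof -
      have "Suc (length h - 2) = length h - 1" using True by simp
      then show ?thesis using True by (subst last_conv_nth) (auto simp del: One_nat_def)
    qed
    ultimately have *: "label (h ! (length h - 2)) \<in> labels (time (h ! (length h - 2)))"
      "time (last h) = Suc (time (h ! (length h - 2)))"
      by simp_all
    define n where "n = time (h ! (length h - 2))"
    \<comment> \<open>The second and the fourth step of a stage admit the same labels, so the copied
      label is legal.\<close>
    have "n mod 4 = 1" "Suc (Suc n) mod 4 = 3" "Suc (Suc n) div 4 = n div 4"
      using mod *(2) unfolding n_def by presburger+
    then show ?thesis using True * by (simp add: labels_def flip: n_def)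
  qed (simp add: labels_0)
  then show "set_pmf (matching_strategy h) \<subseteq> succs game (last h)"
    using lab by (simp add: matching_strategy_def succs_game)
qed

abbreviation matching_prefix :: "nat \<Rightarrow> nat list pmf" where
  "matching_prefix \<equiv> prefix_pmf game matching_strategy (node 0 0)"

lemma matching_prefix_last:
  assumes "h \<in> set_pmf (matching_prefix n)"
  shows "length h = Suc n \<and> last h = h ! n \<and> time (h ! n) = n \<and> label (h ! n) \<in> labels n"
proof -
  have len: "length h = Suc n" "hd h = node 0 0" using length_prefix_pmf[OF assms] by auto
  have "partial_run game h"
    using prefix_pmf_partial_run[OF is_mdp_game is_strategy_matching _ assms] labels_0 by simp
  from partial_run_game_nth[OF this, of n] len show ?thesis
    by (cases "h = []") (auto simp: last_conv_nth)
qed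

lemma matching_prefix_random:
  assumes "n mod 4 \<noteq> 2"
  shows "map_pmf (\<lambda>h. label (h ! Suc n)) (matching_prefix (Suc n)) =
    bind_pmf (matching_prefix n) (\<lambda>h. next_label n (label (h ! n)))"
proof -
  have "map_pmf (\<lambda>h. label (h ! Suc n)) (matching_prefix (Suc n)) =
      bind_pmf (matching_prefix n)
        (\<lambda>h. map_pmf (\<lambda>y. label ((h @ [y]) ! Suc n)) (next_pmf game matching_strategy h))"
    by (simp add: map_bind_pmf map_pmf_comp)
  also have "\<dots> = bind_pmf (matching_prefix n) (\<lambda>h. next_label n (label (h ! n)))"
  proof (rule bind_pmf_cong[OF refl])
    fix h assume "h \<in> set_pmf (matching_prefix n)"
    from matching_prefix_last[OF this] assms
    show "map_pmf (\<lambda>y. label ((h @ [y]) ! Suc n)) (next_pmf game matching_strategy h) =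
        next_label n (label (h ! n))"
      by (simp add: next_pmf_def nth_append map_pmf_comp)
  qed
  finally show ?thesis .
qed

lemma matching_prefix_match:
  assumes "h \<in> set_pmf (matching_prefix (4 * t + 3))"
  shows "label (h ! (4 * t + 3)) = label (h ! (4 * t + 1))"
proof -
  have e: "4 * t + 3 = Suc (4 * t + 2)" by simp
  obtain g y where g: "g \<in> set_pmf (matching_prefix (4 * t + 2))"
    and y: "y \<in> set_pmf (next_pmf game matching_strategy g)" and h: "h = g @ [y]"
    using assms unfolding e prefix_pmf.simps set_bind_pmf set_map_pmf by blast
  have "(4 * t + 2) mod 4 = 2" by presburger
  then have "y = node (Suc (4 * t + 2)) (label (g ! (4 * t + 1)))"
    using y matching_prefix_last[OF g] by (simp add: next_pmf_def matching_strategy_def)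
  then show ?thesis using matching_prefix_last[OF g] by (simp add: h nth_append)
qed

text \<open>The choice equals the drawn level almost surely, and the latter has law
  \<open>level_pmf (level t)\<close>, so the penalty probability is the expected risk.\<close>

lemma prob_risk_matching:
  "measure_pmf.prob (matching_prefix (4 * t + 4)) {h. label (h ! (4 * t + 4)) \<noteq> 0} =
     (\<integral>i. risk (level t) i \<partial>level_pmf (level t))"
proof -
  have e: "4 * t + 4 = Suc (4 * t + 3)" "4 * t + 3 = Suc (4 * t + 2)" "4 * t + 2 = Suc (4 * t + 1)"
    "4 * t + 1 = Suc (4 * t)" by simp_all
  have mod: "(4 * t + 3) mod 4 \<noteq> 2" "(4 * t) mod 4 = 0" by presburger+
  have "measure_pmf.prob (matching_prefix (4 * t + 4)) {h. label (h ! (4 * t + 4)) \<noteq> 0} =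
      measure_pmf.prob (map_pmf (\<lambda>h. label (h ! (4 * t + 4))) (matching_prefix (4 * t + 4))) {a. a \<noteq> 0}"
    by (simp add: vimage_def)
  also have "\<dots> = (\<integral>h. risk (level t) (label (h ! (4 * t + 3))) \<partial>matching_prefix (4 * t + 3))"
    unfolding e(1) matching_prefix_random[OF mod(1)] by (simp only: prob_bind_pmf prob_next_label_risk)
  also have "\<dots> = (\<integral>h. risk (level t) (label (h ! (4 * t + 1))) \<partial>matching_prefix (4 * t + 3))"
    by (rule integral_cong_AE) (auto simp: AE_measure_pmf_iff matching_prefix_match)
  also have "\<dots> = (\<integral>i. risk (level t) i \<partial>map_pmf (\<lambda>h. label (h ! (4 * t + 1))) (matching_prefix (4 * t + 3)))"
    by simp
  \<comment> \<open>The level is fixed at position \<open>4 * t + 1\<close>; the two later steps do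
    not affect its law.\<close>
  also have "map_pmf (\<lambda>h. label (h ! (4 * t + 1))) (matching_prefix (4 * t + 3)) =
      map_pmf (\<lambda>h. label (h ! (4 * t + 1))) (matching_prefix (4 * t + 1))"
    unfolding e(2,3) by (simp only: map_nth_prefix_pmf_Suc le_SucI order_refl)
  also have "\<dots> = level_pmf (level t)"
    using matching_prefix_random[of "4 * t"] mod(2) unfolding e(4) by (simp add: next_label_def)
  finally show ?thesis .
qed

text \<open>The penalty probabilities are summable, so by Borel-Cantelli almost every run has only
  finitely many penalties, and \<open>liminf_payoff_matched\<close> applies.\<close>

lemma measure_TP_matching:
  "measure (run_measure game matching_strategy (node 0 0)) (TP_liminf_ge0 game) = 1"
proof -
  let ?R = "run_measure game matching_strategy (node 0 0)"
  interpret prob_space ?R by (rule prob_space_run_measure)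
  define F where "F t = {\<omega>. map \<omega> [0..<Suc (4 * t + 4)] \<in> {h. label (h ! (4 * t + 4)) \<noteq> 0}}" for t
  have F: "F t \<in> sets ?R" for t unfolding F_def by (rule sets_prefix_event)
  have "summable (\<lambda>t. prob (F t))"
    unfolding F_def measure_prefix_event prob_risk_matching by (rule summable_expected_risk)
  then have "AE \<omega> in ?R. eventually (\<lambda>t. \<omega> \<in> space ?R - F t) sequentially"
    by (intro borel_cantelli_AE1 F) (simp_all add: emeasure_eq_measure)
  then have "AE \<omega> in ?R. \<omega> \<in> TP_liminf_ge0 game"
    using AE_prefix[of game matching_strategy "node 0 0"]
  proof eventually_elim
    case (elim \<omega>)
    have nth: "map \<omega> [0..<Suc n] ! i = \<omega> i" if "i \<le> n" for i n
      using that by (simp add: nth_map del: upt_Suc)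
    have start: "\<omega> 0 = node 0 0" using spec[OF elim(2), of 0] by simp
    have step: "time (\<omega> n) = n \<and> label (\<omega> n) \<in> labels n" for n
      using matching_prefix_last[OF spec[OF elim(2), of n]] nth[of n n] by (simp del: upt_Suc)
    then have run: "\<omega> \<in> runs game" by (simp add: runs_def)
    have match: "label (\<omega> (4 * t + 3)) = label (\<omega> (4 * t + 1))" for t
      using matching_prefix_match[OF spec[OF elim(2), of "4 * t + 3"]] by (simp add: nth del: upt_Suc)
    obtain T where T: "\<And>t. T \<le> t \<Longrightarrow> \<omega> \<notin> F t"
      using elim(1) by (auto simp: eventually_sequentially)
    have "label (\<omega> (4 * t + 4)) = 0" if "T \<le> t" for t
      using T[OF that] nth[of "4 * t + 4" "4 * t + 4"] by (simp add: F_def del: upt_Suc)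
    with step match have "0 \<le> liminf (\<lambda>n. ereal (payoff (\<lambda>n. label (\<omega> n)) n))"
      by (intro liminf_payoff_matched[of _ T]) auto
    with run start show ?case by (simp add: TP_liminf_ge0_game_iff)
  qed
  then show ?thesis by (simp add: prob_eq_1 sets_TP_liminf_ge0)
qed

lemma mdp_value_game: "mdp_value game (node 0 0) (TP_liminf_ge0 game) = 1"
proof (rule antisym)
  have le: "measure (run_measure game \<sigma> (node 0 0)) (TP_liminf_ge0 game) \<le> 1" for \<sigma>
    by (rule prob_space.prob_le_1[OF prob_space_run_measure])
  show "mdp_value game (node 0 0) (TP_liminf_ge0 game) \<le> 1"
    unfolding mdp_value_def by (rule cSUP_least) (use is_strategy_matching le in auto)
  show "1 \<le> mdp_value game (node 0 0) (TP_liminf_ge0 game)"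
    unfolding mdp_value_def measure_TP_matching[symmetric]
    by (rule cSUP_upper) (use is_strategy_matching le in \<open>auto intro!: bdd_aboveI2\<close>)
qed

theorem theorem5p7:
  shows "\<exists>(M :: nat mdp) s0.
    is_mdp M \<and> finitely_branching M \<and> acyclic (transitions M) \<and>
    (\<forall>e\<in>transitions M. reward M e \<in> \<int>) \<and>
    s0 \<in> states M \<and> step_counter_implicit M s0 \<and>
    mdp_value M s0 (TP_liminf_ge0 M) = 1 \<and>
    (\<forall>\<sigma>. FR_strategy M s0 \<sigma> \<longrightarrow> measure (run_measure M \<sigma> s0) (TP_liminf_ge0 M) = 0) \<and>
    (\<forall>k (\<epsilon> :: real). \<epsilon> < 1 \<longrightarrow>
       \<not> (\<exists>\<sigma>. k_bit_Markov_strategy k M s0 \<sigma> \<and> eps_optimal M s0 (TP_liminf_ge0 M) \<epsilon> \<sigma>))"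
proof (intro exI conjI allI impI notI)
  show "node 0 0 \<in> states game" by (simp add: labels_0)
  \<comment> \<open>An \<open>\<epsilon>\<close>-optimal strategy would attain at least
    \<open>1 - \<epsilon> > 0\<close>, but \<open>k\<close>-bit Markov strategies attain 0.\<close>
  show False if "\<epsilon> < 1"
    and "\<exists>\<sigma>. k_bit_Markov_strategy k game (node 0 0) \<sigma> \<and>
      eps_optimal game (node 0 0) (TP_liminf_ge0 game) \<epsilon> \<sigma>" for k and \<epsilon> :: real
    using that k_bit_Markov_measure_TP_eq_0 by (force simp: eps_optimal_def mdp_value_game)
qed (fact is_mdp_game finitely_branching_game acyclic_game reward_game_Ints step_counter_implicit_game
  mdp_value_game FR_measure_TP_eq_0)+

end
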